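(* Let $E$ be a complex Banach space and let $C\in L(E)$ be injective. (i) Suppose that $\mathcal{G}$ is a $C$-distribution semigroup in $E$ with generator $A$. Let $D$ be the set of all eigenvectors of $A$ corresponding to purely imaginary eigenvalues (i.e. eigenvalues in $i\mathbb{R}$, zero included), and let $D_0$ be the set of all eigenvectors of $A$ corresponding to non-zero purely imaginary eigenvalues. Then $\tilde{E}:=\mathrm{span}(D)\subseteq Z(A)$ and $\mathcal{G}$ is $\tilde{E}$-almost periodic. Furthermore, for every $x\in \mathrm{span}(D_0)$ the mapping $t\mapsto \int_0^t G(\delta_s)x\,ds$, $t\ge 0$, is almost periodic. (ii) Suppose that $\mathbf{G}$ is a $C$-distribution cosine function in $E$ with generator $A$. Let $H$ be the set of all eigenvectors of $A$ corresponding to non-positive real eigenvalues, and let $H_0$ be the set of all eigenvectors of $A$ corresponding to negative real eigenvalues. Then $\tilde{E}:=\mathrm{span}(H)\subseteq Z_2(A)$ and $\mathbf{G}$ is $\tilde{E}$-almost periodic. Furthermore, for every $x\in \mathrm{span}(H_0)$ the mappings $t\mapsto \int_0^t G(\delta_s)x\,ds$, $t\ge 0$, and $t\mapsto \int_0^t (t-s)G(\delta_s)x\,ds$, $t\geq 0$, are almost periodic.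
   Context: **Test functions and distributions.** $E$ is a complex Banach space, $L(E)$ the bounded linear operators on $E$, $C\in L(E)$ is injective. $\mathcal{D}=C_0^\infty(\mathbb{R})$ with its usual inductive limit topology; $\mathcal{D}_0$ is the set of $\varphi\in\mathcal{D}$ with $\mathrm{supp}(\varphi)\subseteq[0,\infty)$. For a Banach space $X$, $\mathcal{D}'(X)$ is the space of continuous linear maps $\mathcal{D}\to X$, and $\mathcal{D}'_0(X)$ is the subspace of those with support in $[0,\infty)$. For $\varphi,\psi\in\mathcal{D}$, $(\varphi*_0\psi)(t):=\int_0^t\varphi(t-s)\psi(s)\,ds$, $t\in\mathbb{R}$. **$C$-distribution semigroups.** $\mathcal{G}\in\mathcal{D}_0'(L(E))$ with $C\mathcal{G}(\varphi)=\mathcal{G}(\varphi)C$ for all $\varphi\in\mathcal{D}$ is a $C$-distribution semigroup ($(C\text{-DS})$) iff (a) $\mathcal{G}(\varphi*_0\psi)C=\mathcal{G}(\varphi)\mathcal{G}(\psi)$ for all $\varphi,\psi\in\mathcal{D}$, and (b) $\bigcap_{\varphi\in\mathcal{D}_0}N(\mathcal{G}(\varphi))=\{0\}$. For a scalar distribution $T$ with compact support contained in $[0,\infty)$, $G(T)$ is the closed linear operator with graph $$G(T):=\{(x,y)\in E\times E:\ \mathcal{G}(T*\varphi)x=\mathcal{G}(\varphi)y\ \text{ for all }\varphi\in\mathcal{D}_0\}.$$ In particular $G(\delta_t)$, $t\ge0$, is defined using $\delta_t*\varphi=\varphi(\cdot-t)$. The generator of $\mathcal{G}$ is $A:=G(-\delta')$,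 i.e. $(x,y)\in A$ iff $\mathcal{G}(-\varphi')x=\mathcal{G}(\varphi)y$ for all $\varphi\in\mathcal{D}_0$. **Solution space $Z(A)$.** For a closed linear operator $A$, $Z(A)$ is the set of $x\in E$ for which there is $u(\cdot,x)\in C([0,\infty):E)$ with $\int_0^tu(s,x)\,ds\in D(A)$ and $A\int_0^tu(s,x)\,ds=u(t,x)-x$ for all $t\ge0$. If $A$ generates a $(C\text{-DS})$ $\mathcal{G}$, it is known that $Z(A)$ is the set of all $x\in\bigcap_{t\ge0}D(G(\delta_t))$ for which $t\mapsto G(\delta_t)x$, $t\geq 0$, is continuous, and $u(t,x)=G(\delta_t)x$ for $x\in Z(A)$. **$C$-distribution cosine functions.** Fix $\zeta\in\mathcal{D}$ with $\mathrm{supp}(\zeta)\subseteq[-2,-1]$ and $\int\zeta=1$. For $\varphi\in\mathcal{D}$ put $I(\varphi)(s):=\int_{-\infty}^{s}[\varphi(t)-\zeta(t)\int_{-\infty}^\infty\varphi(u)\,du]\,dt\in\mathcal{D}$; for $\mathbf{G}\in\mathcal{D}'(L(E))$ put $\mathbf{G}^{-1}(\varphi):=-\mathbf{G}(I(\varphi))$. An element $\mathbf{G}\in\mathcal{D}'_0(L(E))$ is a $C$-distribution cosine function ($(C\text{-DCF})$) iff $\mathbf{G}(\varphi)C=C\mathbf{G}(\varphi)$ for all $\varphi\in\mathcal{D}$, $\mathbf{G}^{-1}(\varphi*_0\psi)C=\mathbf{G}^{-1}(\varphi)\mathbf{G}(\psi)+\mathbf{G}(\varphi)\mathbf{G}^{-1}(\psi)$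 for all $\varphi,\psi\in\mathcal{D}$, and: $x=y=0$ iff $\mathbf{G}(\varphi)x+\mathbf{G}^{-1}(\varphi)y=0$ for all $\varphi\in\mathcal{D}_0$. Its generator is $A:=\{(x,y)\in E\times E:\ \mathbf{G}^{-1}(\varphi'')x=\mathbf{G}^{-1}(\varphi)y\ \text{for all }\varphi\in\mathcal{D}_0\}$. **$Z_2(A)$ and $G(\delta_t)$ in the cosine case.** $Z_2(A)$ is the set of $x\in E$ for which there is a continuous $u(\cdot;x,0):[0,\infty)\to E$ with $\int_0^t(t-s)u(s;x,0)\,ds\in D(A)$ and $A\int_0^t(t-s)u(s;x,0)\,ds=u(t;x,0)-x$ for all $t\ge0$. If $A$ generates a $(C\text{-DCF})$ $\mathbf{G}$, then it is known that $\mathcal{G}:=\begin{pmatrix}\mathbf{G}&\mathbf{G}^{-1}\\ \mathbf{G}'-\delta\otimes C&\mathbf{G}\end{pmatrix}$ is a $(\mathcal{C}\text{-DS})$ in $E\oplus E$ generated by $\mathcal{A}=\begin{pmatrix} 0 & I \\ A & 0 \end{pmatrix}$, where $\mathcal{C}=\begin{pmatrix} C & 0 \\ 0 & C \end{pmatrix}$; for $x\in Z_2(A)$ and $t\ge0$ one defines $G(\delta_t)x:=\pi_2\big(\mathcal{G}(\delta_t)\binom{0}{x}\big)$, where $\pi_2$ is the projection to the second coordinate and $\mathcal{G}(\delta_t)$ is the closed linear operator in $E\oplus E$ with graph $\{(w,z)\in (E\oplus E)\times(E\oplus E):\ \mathcal{G}(\delta_t*\varphi)w=\mathcal{G}(\varphi)z\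 \text{ for all }\varphi\in\mathcal{D}_0\}$, $\mathcal{G}$ being here this $(\mathcal{C}\text{-DS})$ in $E\oplus E$. One has $G(\delta_t)x=u(t;x,0)$. **Almost periodicity.** A continuous function $f:[0,\infty)\to E$ is almost periodic iff for each $\epsilon>0$ there is $l>0$ such that every subinterval of $[0,\infty)$ of length $l$ contains some $\tau$ with $\|f(t+\tau)-f(t)\|\le\epsilon$ for all $t\ge0$. For a linear subspace $\tilde E$ of $Z(A)$ (semigroup case), resp. of $Z_2(A)$ (cosine case), $\mathcal{G}$, resp. $\mathbf{G}$, is $\tilde E$-almost periodic iff for each $x\in\tilde E$ the mapping $t\mapsto G(\delta_t)x$, $t\ge0$, is almost periodic. *)

theory Defs
  imports "HOL-Analysis.Analysis"
begin

section \<open>Complex Banach spaces and bounded complex-linear operators\<close>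

class complex_normed_vector = real_normed_vector +
  fixes scaleC :: "complex \<Rightarrow> 'a \<Rightarrow> 'a" (infixr \<open>*\<^sub>C\<close> 75)
  assumes scaleC_add_right: "a *\<^sub>C (x + y) = a *\<^sub>C x + a *\<^sub>C y"
    and scaleC_add_left: "(a + b) *\<^sub>C x = a *\<^sub>C x + b *\<^sub>C x"
    and scaleC_scaleC: "a *\<^sub>C b *\<^sub>C x = (a * b) *\<^sub>C x"
    and scaleC_of_real: "complex_of_real r *\<^sub>C x = r *\<^sub>R x"
    and norm_scaleC: "norm (a *\<^sub>C x) = cmod a * norm x"

class complex_banach = complex_normed_vector + banach

lemma scaleC_one: "1 *\<^sub>C x = (x :: 'a::complex_normed_vector)"
  using scaleC_of_real[of 1 x] by simp

global_interpretation complex_vector: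
  vector_space "scaleC :: complex \<Rightarrow> 'a \<Rightarrow> 'a::complex_normed_vector"
  defines cspan = complex_vector.span
    and csubspace = complex_vector.subspace
  by unfold_locales
    (simp_all add: scaleC_add_right scaleC_add_left scaleC_scaleC scaleC_one)

instantiation complex :: complex_banach
begin
definition scaleC_complex :: "complex \<Rightarrow> complex \<Rightarrow> complex"
  where "scaleC_complex a x = a * x"
instance
  by standard (simp_all add: scaleC_complex_def algebra_simps norm_mult scaleR_conv_of_real)
end

instantiation prod :: (complex_normed_vector, complex_normed_vector) complex_normed_vector
begin
definition scaleC_prod :: "complex \<Rightarrow> 'a \<times> 'b \<Rightarrow> 'a \<times> 'b"
  where "scaleC_prod a p = (a *\<^sub>C fst p, a *\<^sub>C snd p)"
instance
proof
  fix a b :: complex and r :: real and x y :: "'a \<times> 'b"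
  show "a *\<^sub>C (x + y) = a *\<^sub>C x + a *\<^sub>C y" "(a + b) *\<^sub>C x = a *\<^sub>C x + b *\<^sub>C x"
    "a *\<^sub>C b *\<^sub>C x = (a * b) *\<^sub>C x" "complex_of_real r *\<^sub>C x = r *\<^sub>R x"
    by (simp_all add: scaleC_prod_def scaleC_add_right scaleC_add_left scaleC_scaleC
        scaleC_of_real scaleR_prod_def)
  have "norm (a *\<^sub>C x) = sqrt ((cmod a)\<^sup>2 * ((norm (fst x))\<^sup>2 + (norm (snd x))\<^sup>2))"
    by (simp add: scaleC_prod_def norm_prod_def norm_scaleC power_mult_distrib algebra_simps)
  then show "norm (a *\<^sub>C x) = cmod a * norm x"
    by (simp add: real_sqrt_mult norm_prod_def)
qed
end

instance prod :: (complex_banach, complex_banach) complex_banach ..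

lemma bounded_linear_scaleC: "bounded_linear (\<lambda>x :: 'a::complex_normed_vector. a *\<^sub>C x)"
proof (rule bounded_linear_intro[where K = "cmod a"])
  fix r :: real and x y :: 'a
  show "a *\<^sub>C (x + y) = a *\<^sub>C x + a *\<^sub>C y" by (rule scaleC_add_right)
  show "a *\<^sub>C r *\<^sub>R x = r *\<^sub>R a *\<^sub>C x"
    by (simp add: scaleC_of_real[symmetric] scaleC_scaleC mult.commute)
  show "norm (a *\<^sub>C x) \<le> norm x * cmod a" by (simp add: norm_scaleC mult.commute)
qed

text \<open>The real-linear bounded operators into a complex space form a complex normed space
  (scalars act on the values); \<open>L(E)\<close> is its closed complex subspace of complex-linear
  operators, introduced as \<open>clinear_ops\<close> below.\<close>

instantiation blinfun :: (real_normed_vector, complex_normed_vector) complex_normed_vector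
begin
lift_definition scaleC_blinfun :: "complex \<Rightarrow> 'a \<Rightarrow>\<^sub>L 'b \<Rightarrow> 'a \<Rightarrow>\<^sub>L 'b" is "\<lambda>a f x. a *\<^sub>C f x"
  by (rule bounded_linear_compose[OF bounded_linear_scaleC])
instance
proof
  fix a b :: complex and r :: real and x y :: "'a \<Rightarrow>\<^sub>L 'b"
  show "a *\<^sub>C (x + y) = a *\<^sub>C x + a *\<^sub>C y" "(a + b) *\<^sub>C x = a *\<^sub>C x + b *\<^sub>C x"
    "a *\<^sub>C b *\<^sub>C x = (a * b) *\<^sub>C x" "complex_of_real r *\<^sub>C x = r *\<^sub>R x"
    by (transfer, simp add: scaleC_add_right scaleC_add_left scaleC_scaleC scaleC_of_real)+
  have le: "norm (c *\<^sub>C z) \<le> cmod c * norm z" for c and z :: "'a \<Rightarrow>\<^sub>L 'b"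
  proof (rule norm_blinfun_bound)
    fix v
    have "norm (blinfun_apply (c *\<^sub>C z) v) = cmod c * norm (blinfun_apply z v)"
      by (simp add: scaleC_blinfun.rep_eq norm_scaleC)
    also have "\<dots> \<le> cmod c * (norm z * norm v)"
      by (intro mult_left_mono norm_blinfun) auto
    finally show "norm (blinfun_apply (c *\<^sub>C z) v) \<le> cmod c * norm z * norm v"
      by (simp add: mult.assoc)
  qed auto
  show "norm (a *\<^sub>C x) = cmod a * norm x"
  proof (cases "a = 0")
    case True
    then show ?thesis using le[of a x] by simp
  next
    case False
    have "inverse a *\<^sub>C a *\<^sub>C x = x"
    proof (rule blinfun_eqI)
      fix v
      show "blinfun_apply (inverse a *\<^sub>C a *\<^sub>C x) v = blinfun_apply x v"
        using False by (simp add: scaleC_blinfun.rep_eq scaleC_scaleC scaleC_one)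
    qed
    then have "norm x \<le> inverse (cmod a) * norm (a *\<^sub>C x)"
      using le[of "inverse a" "a *\<^sub>C x"] by (simp add: norm_inverse)
    then have "cmod a * norm x \<le> norm (a *\<^sub>C x)"
      using False by (simp add: field_simps)
    then show ?thesis using le[of a x] by simp
  qed
qed
end

instance blinfun :: (real_normed_vector, complex_banach) complex_banach ..

definition clinear_ops :: "('a::complex_normed_vector \<Rightarrow>\<^sub>L 'b::complex_normed_vector) set"
  where "clinear_ops =
    {T. \<forall>c x. blinfun_apply T (c *\<^sub>C x) = c *\<^sub>C blinfun_apply T x}"

text \<open>Linear operators that need not be everywhere defined are represented by their graphs.\<close>

definition eigenvectors :: "('a::complex_normed_vector \<times> 'a) set \<Rightarrow> complex set \<Rightarrow> 'a set"
  where "eigenvectors A \<Lambda> = {x. x \<noteq> 0 \<and> (\<exists>k\<in>\<Lambda>. (x, k *\<^sub>C x) \<in> A)}"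

text \<open>Meaningful only for single-valued \<open>A\<close> and \<open>x \<in> Domain A\<close>.\<close>

definition graph_apply :: "('a \<times> 'b) set \<Rightarrow> 'a \<Rightarrow> 'b"
  where "graph_apply A x = (THE y. (x, y) \<in> A)"


section \<open>Test functions\<close>

definition vderiv :: "(real \<Rightarrow> 'a::real_normed_vector) \<Rightarrow> real \<Rightarrow> 'a"
  where "vderiv f = (\<lambda>t. vector_derivative f (at t))"

definition fsupp :: "(real \<Rightarrow> 'a::zero) \<Rightarrow> real set"
  where "fsupp f = closure {t. f t \<noteq> 0}"

definition test_funs :: "(real \<Rightarrow> complex) set"
  where "test_funs =
    {\<phi>. (\<forall>n t. (vderiv ^^ n) \<phi> differentiable (at t)) \<and> compact (fsupp \<phi>)}"

definition test_funs0 :: "(real \<Rightarrow> complex) set"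
  where "test_funs0 = {\<phi> \<in> test_funs. fsupp \<phi> \<subseteq> {0..}}"

text \<open>The inductive limit topology is the finest locally convex topology for which all
  inclusions of the spaces of test functions supported in a fixed compact set \<open>K\<close> are
  continuous.  A base at \<open>0\<close> is given by the absolutely convex sets whose trace on each of
  these Frechet spaces is a neighbourhood of \<open>0\<close>.\<close>

definition test_nbhd0 :: "(real \<Rightarrow> complex) set \<Rightarrow> bool"
  where "test_nbhd0 U \<longleftrightarrow> U \<subseteq> test_funs \<and>
    (\<forall>\<phi>\<in>U. \<forall>\<psi>\<in>U. \<forall>a b. cmod a + cmod b \<le> 1 \<longrightarrow> (\<lambda>t. a * \<phi> t + b * \<psi> t) \<in> U) \<and>
    (\<forall>K. compact K \<longrightarrow> (\<exists>m. \<exists>\<epsilon>>0.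
      {\<phi> \<in> test_funs. fsupp \<phi> \<subseteq> K \<and> (\<forall>j\<le>m. \<forall>t. cmod ((vderiv ^^ j) \<phi> t) < \<epsilon>)} \<subseteq> U))"

definition test_open :: "(real \<Rightarrow> complex) set \<Rightarrow> bool"
  where "test_open V \<longleftrightarrow> V \<subseteq> test_funs \<and>
    (\<forall>\<phi>\<in>V. \<exists>U. test_nbhd0 U \<and> (\<forall>\<psi>\<in>U. (\<lambda>t. \<phi> t + \<psi> t) \<in> V))"

definition test_topology :: "(real \<Rightarrow> complex) topology"
  where "test_topology = topology test_open"

lemma test_nbhd0_Int:
  assumes U: "test_nbhd0 U" and W: "test_nbhd0 W"
  shows "test_nbhd0 (U \<inter> W)"
  unfolding test_nbhd0_def
proof (intro conjI allI ballI impI)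
  show "U \<inter> W \<subseteq> test_funs" using U unfolding test_nbhd0_def by blast
next
  fix \<phi> \<psi> a b assume *: "\<phi> \<in> U \<inter> W" "\<psi> \<in> U \<inter> W" "cmod a + cmod b \<le> 1"
  have "(\<lambda>t. a * \<phi> t + b * \<psi> t) \<in> U"
    by (rule U[unfolded test_nbhd0_def, THEN conjunct2, THEN conjunct1, rule_format]) (use * in auto)
  moreover have "(\<lambda>t. a * \<phi> t + b * \<psi> t) \<in> W"
    by (rule W[unfolded test_nbhd0_def, THEN conjunct2, THEN conjunct1, rule_format]) (use * in auto)
  ultimately show "(\<lambda>t. a * \<phi> t + b * \<psi> t) \<in> U \<inter> W" by simp
next
  fix K :: "real set" assume K: "compact K"
  let ?N = "\<lambda>m \<epsilon>. {\<phi> \<in> test_funs. fsupp \<phi> \<subseteq> K \<and>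
      (\<forall>j\<le>m. \<forall>t. cmod ((vderiv ^^ j) \<phi> t) < \<epsilon>)}"
  have "\<exists>m. \<exists>\<epsilon>>0. ?N m \<epsilon> \<subseteq> U"
    by (rule U[unfolded test_nbhd0_def, THEN conjunct2, THEN conjunct2, rule_format, OF K])
  then obtain m \<epsilon> where 1: "\<epsilon> > 0" "?N m \<epsilon> \<subseteq> U" by (elim exE conjE)
  have "\<exists>m. \<exists>\<epsilon>>0. ?N m \<epsilon> \<subseteq> W"
    by (rule W[unfolded test_nbhd0_def, THEN conjunct2, THEN conjunct2, rule_format, OF K])
  then obtain n \<delta> where 2: "\<delta> > 0" "?N n \<delta> \<subseteq> W" by (elim exE conjE)
  have "?N (max m n) (min \<epsilon> \<delta>) \<subseteq> ?N m \<epsilon>" "?N (max m n) (min \<epsilon> \<delta>) \<subseteq> ?N n \<delta>"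
    by (simp_all add: subset_iff)
  then have "?N (max m n) (min \<epsilon> \<delta>) \<subseteq> U \<inter> W"
    by (intro Int_greatest order_trans[OF _ 1(2)] order_trans[OF _ 2(2)])
  moreover have "min \<epsilon> \<delta> > 0" using 1 2 by simp
  ultimately show "\<exists>m. \<exists>\<epsilon>>0. ?N m \<epsilon> \<subseteq> U \<inter> W" by (intro exI conjI)
qed

lemma test_openD:
  assumes "test_open V" "\<phi> \<in> V"
  obtains U where "test_nbhd0 U" "\<forall>\<psi>\<in>U. (\<lambda>t. \<phi> t + \<psi> t) \<in> V"
  using assms(1)[unfolded test_open_def, THEN conjunct2, THEN bspec, OF assms(2)]
  by (elim exE conjE)

lemma openin_test_topology: "openin test_topology = test_open"
proof -
  have Int: "test_open (V \<inter> W)" if V: "test_open V" and W: "test_open W" for V W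
    unfolding test_open_def
  proof (intro conjI ballI)
    show "V \<inter> W \<subseteq> test_funs" using V unfolding test_open_def by blast
    fix \<phi> assume \<phi>: "\<phi> \<in> V \<inter> W"
    obtain U1 where U1: "test_nbhd0 U1" "\<forall>\<psi>\<in>U1. (\<lambda>t. \<phi> t + \<psi> t) \<in> V"
      using test_openD[OF V IntD1[OF \<phi>]] .
    obtain U2 where U2: "test_nbhd0 U2" "\<forall>\<psi>\<in>U2. (\<lambda>t. \<phi> t + \<psi> t) \<in> W"
      using test_openD[OF W IntD2[OF \<phi>]] .
    show "\<exists>U. test_nbhd0 U \<and> (\<forall>\<psi>\<in>U. (\<lambda>t. \<phi> t + \<psi> t) \<in> V \<inter> W)"
      by (intro exI[of _ "U1 \<inter> U2"] conjI ballI IntI test_nbhd0_Int U1(1) U2(1)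
          U1(2)[rule_format] U2(2)[rule_format]) simp_all
  qed
  have Union: "test_open (\<Union>\<K>)" if \<K>: "\<forall>V\<in>\<K>. test_open V" for \<K>
    unfolding test_open_def
  proof (intro conjI ballI)
    show "\<Union>\<K> \<subseteq> test_funs" using \<K> unfolding test_open_def by (intro Union_least) simp
    fix \<phi> assume "\<phi> \<in> \<Union>\<K>"
    then obtain V where V: "V \<in> \<K>" "\<phi> \<in> V" by (rule UnionE)
    obtain U where U: "test_nbhd0 U" "\<forall>\<psi>\<in>U. (\<lambda>t. \<phi> t + \<psi> t) \<in> V"
      using test_openD[OF bspec[OF \<K> V(1)] V(2)] .
    show "\<exists>U. test_nbhd0 U \<and> (\<forall>\<psi>\<in>U. (\<lambda>t. \<phi> t + \<psi> t) \<in> \<Union>\<K>)"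
      by (intro exI[of _ U] conjI ballI UnionI[OF V(1)] U(1) U(2)[rule_format])
  qed
  have "istopology test_open"
    unfolding istopology_def by (intro conjI allI impI Int Union)
  then show ?thesis
    unfolding test_topology_def by (rule topology_inverse')
qed


section \<open>Vector-valued distributions\<close>

text \<open>A distribution is a function on all of \<open>real \<Rightarrow> complex\<close>; only its values on test
  functions are relevant.\<close>

definition distributions :: "((real \<Rightarrow> complex) \<Rightarrow> 'x::complex_banach) set"
  where "distributions = {G.
    (\<forall>\<phi>\<in>test_funs. \<forall>\<psi>\<in>test_funs. \<forall>a b.
      G (\<lambda>t. a * \<phi> t + b * \<psi> t) = a *\<^sub>C G \<phi> + b *\<^sub>C G \<psi>) \<and>
    continuous_map test_topology euclidean G}"

definition dist_supp :: "((real \<Rightarrow> complex) \<Rightarrow> 'x::zero) \<Rightarrow> real set"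
  where "dist_supp G =
    - \<Union>{U. open U \<and> (\<forall>\<phi>\<in>test_funs. fsupp \<phi> \<subseteq> U \<longrightarrow> G \<phi> = 0)}"

definition distributions0 :: "((real \<Rightarrow> complex) \<Rightarrow> 'x::complex_banach) set"
  where "distributions0 = {G \<in> distributions. dist_supp G \<subseteq> {0..}}"

definition op_distributions0 ::
    "((real \<Rightarrow> complex) \<Rightarrow> ('e::complex_banach \<Rightarrow>\<^sub>L 'e)) set"
  where "op_distributions0 = {G \<in> distributions0. \<forall>\<phi>\<in>test_funs. G \<phi> \<in> clinear_ops}"

definition delta :: "real \<Rightarrow> (real \<Rightarrow> complex) \<Rightarrow> complex"
  where "delta t = (\<lambda>\<phi>. \<phi> t)"

definition dist_deriv :: "((real \<Rightarrow> complex) \<Rightarrow> 'x::ab_group_add) \<Rightarrow> (real \<Rightarrow> complex) \<Rightarrow> 'x"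
  where "dist_deriv T = (\<lambda>\<phi>. - T (vderiv \<phi>))"

definition dist_conv ::
    "((real \<Rightarrow> complex) \<Rightarrow> complex) \<Rightarrow> (real \<Rightarrow> complex) \<Rightarrow> real \<Rightarrow> complex"
  where "dist_conv T \<phi> = (\<lambda>s. T (\<lambda>r. \<phi> (s - r)))"

text \<open>The integral is oriented: for \<open>t < 0\<close> it is minus the integral over \<open>[t, 0]\<close>.\<close>

definition conv0 :: "(real \<Rightarrow> complex) \<Rightarrow> (real \<Rightarrow> complex) \<Rightarrow> real \<Rightarrow> complex"
  where "conv0 \<phi> \<psi> = (\<lambda>t. LBINT s=0..t. \<phi> (t - s) * \<psi> s)"

lemma dist_conv_delta: "dist_conv (delta t) \<phi> = (\<lambda>s. \<phi> (s - t))"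
  by (simp add: dist_conv_def delta_def)

lemma dist_conv_minus_delta_deriv:
  assumes "\<phi> \<in> test_funs"
  shows "dist_conv (\<lambda>\<psi>. - dist_deriv (delta 0) \<psi>) \<phi> = (\<lambda>s. - vderiv \<phi> s)"
proof
  fix s
  have "\<phi> differentiable (at s)"
    using assms[unfolded test_funs_def mem_Collect_eq, THEN conjunct1, THEN spec[of _ 0]] by simp
  then have "(\<phi> has_vector_derivative vderiv \<phi> s) (at (s - 0))"
    by (simp add: vderiv_def vector_derivative_works)
  moreover have "((\<lambda>r. s - r) has_vector_derivative (-1)) (at (0::real))"
    by (auto intro!: derivative_eq_intros)
  ultimately have "((\<phi> \<circ> (\<lambda>r. s - r)) has_vector_derivative (-1) *\<^sub>R vderiv \<phi> s) (at 0)"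
    by (intro vector_diff_chain_at) auto
  then have "vector_derivative (\<lambda>r. \<phi> (s - r)) (at 0) = - vderiv \<phi> s"
    by (intro vector_derivative_at) (simp add: o_def)
  then show "dist_conv (\<lambda>\<psi>. - dist_deriv (delta 0) \<psi>) \<phi> s = - vderiv \<phi> s"
    by (simp add: dist_conv_def dist_deriv_def delta_def vderiv_def)
qed

text \<open>The graph of \<open>G(T)\<close>, for a scalar distribution \<open>T\<close> with compact support in
  \<open>[0,\<infinity>)\<close>.\<close>

definition dist_op ::
    "((real \<Rightarrow> complex) \<Rightarrow> ('e::complex_banach \<Rightarrow>\<^sub>L 'e)) \<Rightarrow>
     ((real \<Rightarrow> complex) \<Rightarrow> complex) \<Rightarrow> ('e \<times> 'e) set"
  where "dist_op G T = {(x, y). \<forall>\<phi>\<in>test_funs0.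
    blinfun_apply (G (dist_conv T \<phi>)) x = blinfun_apply (G \<phi>) y}"


section \<open>\<open>C\<close>-distribution semigroups\<close>

definition C_DS ::
    "('e::complex_banach \<Rightarrow>\<^sub>L 'e) \<Rightarrow> ((real \<Rightarrow> complex) \<Rightarrow> ('e \<Rightarrow>\<^sub>L 'e)) \<Rightarrow> bool"
  where "C_DS C G \<longleftrightarrow> G \<in> op_distributions0 \<and>
    (\<forall>\<phi>\<in>test_funs. C o\<^sub>L G \<phi> = G \<phi> o\<^sub>L C) \<and>
    (\<forall>\<phi>\<in>test_funs. \<forall>\<psi>\<in>test_funs. G (conv0 \<phi> \<psi>) o\<^sub>L C = G \<phi> o\<^sub>L G \<psi>) \<and>
    (\<Inter>\<phi>\<in>test_funs0. {x. blinfun_apply (G \<phi>) x = 0}) = {0}"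

definition ds_generator ::
    "((real \<Rightarrow> complex) \<Rightarrow> ('e::complex_banach \<Rightarrow>\<^sub>L 'e)) \<Rightarrow> ('e \<times> 'e) set"
  where "ds_generator G = dist_op G (\<lambda>\<psi>. - dist_deriv (delta 0) \<psi>)"

lemma ds_generator_iff:
  "(x, y) \<in> ds_generator G \<longleftrightarrow>
    (\<forall>\<phi>\<in>test_funs0. blinfun_apply (G (\<lambda>s. - vderiv \<phi> s)) x = blinfun_apply (G \<phi>) y)"
  by (auto simp: ds_generator_def dist_op_def dist_conv_minus_delta_deriv test_funs0_def)

definition solution_space :: "('e::complex_banach \<times> 'e) set \<Rightarrow> 'e set"
  where "solution_space A = {x. \<exists>u :: real \<Rightarrow> 'e. continuous_on {0..} u \<and>
    (\<forall>t\<ge>0. (integral {0..t} u, u t - x) \<in> A)}"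

definition ds_orbit ::
    "((real \<Rightarrow> complex) \<Rightarrow> ('e::complex_banach \<Rightarrow>\<^sub>L 'e)) \<Rightarrow> 'e \<Rightarrow> real \<Rightarrow> 'e"
  where "ds_orbit G x t = graph_apply (dist_op G (delta t)) x"


section \<open>\<open>C\<close>-distribution cosine functions\<close>

definition cutoff :: "(real \<Rightarrow> complex) \<Rightarrow> bool"
  where "cutoff \<zeta> \<longleftrightarrow> \<zeta> \<in> test_funs \<and> fsupp \<zeta> \<subseteq> {-2..-1} \<and> integral UNIV \<zeta> = 1"

definition primitive :: "(real \<Rightarrow> complex) \<Rightarrow> (real \<Rightarrow> complex) \<Rightarrow> real \<Rightarrow> complex"
  where "primitive \<zeta> \<phi> = (\<lambda>s. integral {..s} (\<lambda>t. \<phi> t - \<zeta> t * integral UNIV \<phi>))"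

definition dist_inv ::
    "(real \<Rightarrow> complex) \<Rightarrow> ((real \<Rightarrow> complex) \<Rightarrow> 'x::ab_group_add) \<Rightarrow> (real \<Rightarrow> complex) \<Rightarrow> 'x"
  where "dist_inv \<zeta> G = (\<lambda>\<phi>. - G (primitive \<zeta> \<phi>))"

definition C_DCF ::
    "(real \<Rightarrow> complex) \<Rightarrow> ('e::complex_banach \<Rightarrow>\<^sub>L 'e) \<Rightarrow>
     ((real \<Rightarrow> complex) \<Rightarrow> ('e \<Rightarrow>\<^sub>L 'e)) \<Rightarrow> bool"
  where "C_DCF \<zeta> C G \<longleftrightarrow> G \<in> op_distributions0 \<and>
    (\<forall>\<phi>\<in>test_funs. G \<phi> o\<^sub>L C = C o\<^sub>L G \<phi>) \<and>
    (\<forall>\<phi>\<in>test_funs. \<forall>\<psi>\<in>test_funs.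
      dist_inv \<zeta> G (conv0 \<phi> \<psi>) o\<^sub>L C =
        (dist_inv \<zeta> G \<phi> o\<^sub>L G \<psi>) + (G \<phi> o\<^sub>L dist_inv \<zeta> G \<psi>)) \<and>
    (\<forall>x y. x = 0 \<and> y = 0 \<longleftrightarrow>
      (\<forall>\<phi>\<in>test_funs0. blinfun_apply (G \<phi>) x + blinfun_apply (dist_inv \<zeta> G \<phi>) y = 0))"

definition dcf_generator ::
    "(real \<Rightarrow> complex) \<Rightarrow> ((real \<Rightarrow> complex) \<Rightarrow> ('e::complex_banach \<Rightarrow>\<^sub>L 'e)) \<Rightarrow>
     ('e \<times> 'e) set"
  where "dcf_generator \<zeta> G = {(x, y). \<forall>\<phi>\<in>test_funs0.
    blinfun_apply (dist_inv \<zeta> G (vderiv (vderiv \<phi>))) x = blinfun_apply (dist_inv \<zeta> G \<phi>) y}"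

definition solution_space2 :: "('e::complex_banach \<times> 'e) set \<Rightarrow> 'e set"
  where "solution_space2 A = {x. \<exists>u :: real \<Rightarrow> 'e. continuous_on {0..} u \<and>
    (\<forall>t\<ge>0. (integral {0..t} (\<lambda>s. (t - s) *\<^sub>R u s), u t - x) \<in> A)}"

lift_definition block_op ::
    "('a::real_normed_vector \<Rightarrow>\<^sub>L 'a) \<Rightarrow> ('a \<Rightarrow>\<^sub>L 'a) \<Rightarrow> ('a \<Rightarrow>\<^sub>L 'a) \<Rightarrow> ('a \<Rightarrow>\<^sub>L 'a) \<Rightarrow>
     (('a \<times> 'a) \<Rightarrow>\<^sub>L ('a \<times> 'a))"
  is "\<lambda>T11 T12 T21 T22 p. (T11 (fst p) + T12 (snd p), T21 (fst p) + T22 (snd p))"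
  by (intro bounded_linear_Pair bounded_linear_add
      bounded_linear_compose[OF _ bounded_linear_fst]
      bounded_linear_compose[OF _ bounded_linear_snd])

definition dcf_semigroup ::
    "(real \<Rightarrow> complex) \<Rightarrow> ('e::complex_banach \<Rightarrow>\<^sub>L 'e) \<Rightarrow>
     ((real \<Rightarrow> complex) \<Rightarrow> ('e \<Rightarrow>\<^sub>L 'e)) \<Rightarrow> (real \<Rightarrow> complex) \<Rightarrow> (('e \<times> 'e) \<Rightarrow>\<^sub>L ('e \<times> 'e))"
  where "dcf_semigroup \<zeta> C G = (\<lambda>\<phi>. block_op
    (G \<phi>)                                (dist_inv \<zeta> G \<phi>)
    (dist_deriv G \<phi> - delta 0 \<phi> *\<^sub>C C)   (G \<phi>))"

definition dcf_orbit ::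
    "(real \<Rightarrow> complex) \<Rightarrow> ('e::complex_banach \<Rightarrow>\<^sub>L 'e) \<Rightarrow>
     ((real \<Rightarrow> complex) \<Rightarrow> ('e \<Rightarrow>\<^sub>L 'e)) \<Rightarrow> 'e \<Rightarrow> real \<Rightarrow> 'e"
  where "dcf_orbit \<zeta> C G x t =
    snd (graph_apply (dist_op (dcf_semigroup \<zeta> C G) (delta t)) (0, x))"


section \<open>Almost periodicity\<close>

definition almost_periodic :: "(real \<Rightarrow> 'a::real_normed_vector) \<Rightarrow> bool"
  where "almost_periodic f \<longleftrightarrow> continuous_on {0..} f \<and>
    (\<forall>\<epsilon>>0. \<exists>l>0. \<forall>a\<ge>0. \<exists>\<tau>\<in>{a..a + l}. \<forall>t\<ge>0. norm (f (t + \<tau>) - f t) \<le> \<epsilon>)"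

text \<open>The domain conditions make sure that \<open>graph_apply\<close> returns a genuine value; the
  subspaces considered are contained in the solution space.\<close>

definition ds_almost_periodic ::
    "((real \<Rightarrow> complex) \<Rightarrow> ('e::complex_banach \<Rightarrow>\<^sub>L 'e)) \<Rightarrow> 'e set \<Rightarrow> bool"
  where "ds_almost_periodic G S \<longleftrightarrow>
    csubspace S \<and> S \<subseteq> solution_space (ds_generator G) \<and>
    (\<forall>x\<in>S. (\<forall>t\<ge>0. x \<in> Domain (dist_op G (delta t))) \<and> almost_periodic (ds_orbit G x))"

definition dcf_almost_periodic ::
    "(real \<Rightarrow> complex) \<Rightarrow> ('e::complex_banach \<Rightarrow>\<^sub>L 'e) \<Rightarrow>
     ((real \<Rightarrow> complex) \<Rightarrow> ('e \<Rightarrow>\<^sub>L 'e)) \<Rightarrow> 'e set \<Rightarrow> bool"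
  where "dcf_almost_periodic \<zeta> C G S \<longleftrightarrow>
    csubspace S \<and> S \<subseteq> solution_space2 (dcf_generator \<zeta> G) \<and>
    (\<forall>x\<in>S. (\<forall>t\<ge>0. (0, x) \<in> Domain (dist_op (dcf_semigroup \<zeta> C G) (delta t))) \<and>
      almost_periodic (dcf_orbit \<zeta> C G x))"

end

theory Submission
  imports Defs
begin

text \<open>For an eigenvector \<open>A x = k x\<close> one expects \<open>G(\<delta>\<^sub>t) x = exp (k * t) x\<close> in the semigroup case,
  and \<open>G(\<delta>\<^sub>t) x = cos (m * t) x\<close> with \<open>k = - m\<^sup>2\<close> in the cosine case.  Both follow algebraically
  from the definition of the generator: the difference of the two sides of the identity to be
  tested on \<open>\<phi>\<close> is the generator relation for another test function \<open>\<psi>\<close> supported in \<open>[0,\<infinity>)\<close>,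
  namely the solution of \<open>\<psi>' + k \<psi> = exp (k * t) \<phi> - \<phi> (\<sqdot> - t)\<close>, respectively of
  \<open>\<psi>'' + m\<^sup>2 \<psi> = \<phi> (\<sqdot> - t) - cos (m * t) \<phi> + (sin (m * t) / m) \<phi>'\<close>, whose support is compact.
  Orbits through the span are therefore trigonometric polynomials, and so are their primitives
  when the eigenvalue \<open>0\<close> is excluded.\<close>


section \<open>Test functions\<close>

definition smooth :: "(real \<Rightarrow> complex) \<Rightarrow> bool"
  where "smooth f \<longleftrightarrow> (\<forall>n t. (vderiv ^^ n) f differentiable (at t))"

text \<open>Smoothness is a greatest fixed point, so one set of differentiable functions closed
  under \<open>vderiv\<close> is enough. This replaces formulas for higher derivatives: each
  stability result below exhibits such a set.\<close>

lemma smooth_coinduct: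
  assumes "f \<in> P" and P: "\<And>g. g \<in> P \<Longrightarrow> (\<forall>t. g differentiable (at t)) \<and> vderiv g \<in> P"
  shows "smooth f"
proof -
  have "(vderiv ^^ n) f \<in> P" for n
    by (induction n) (use assms in auto)
  then show ?thesis using P unfolding smooth_def by blast
qed

lemma smooth_differentiable: "smooth f \<Longrightarrow> f differentiable (at t)"
  unfolding smooth_def by (metis funpow_0)

lemma smooth_vderiv: "smooth f \<Longrightarrow> smooth (vderiv f)"
  unfolding smooth_def by (metis funpow_Suc_right o_apply)

lemma vderivI: "(\<And>t. (f has_vector_derivative g t) (at t)) \<Longrightarrow> vderiv f = g"
  by (auto simp: vderiv_def vector_derivative_at)

lemma vderivD: "(\<And>t. f differentiable (at t)) \<Longrightarrow> (f has_vector_derivative vderiv f t) (at t)"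
  by (simp add: vderiv_def vector_derivative_works)

lemma smooth_has_vderiv: "smooth f \<Longrightarrow> (f has_vector_derivative vderiv f t) (at t)"
  by (simp add: vderivD smooth_differentiable)

lemma smooth_continuous: "smooth f \<Longrightarrow> continuous_on S f"
  by (meson continuous_at_imp_continuous_on differentiable_imp_continuous_within
      smooth_differentiable)

lemma smoothI:
  assumes "\<And>t. (f has_vector_derivative g t) (at t)" "smooth g"
  shows "smooth f"
proof (rule smooth_coinduct[of f "insert f {h. smooth h}"])
  have "vderiv f = g" by (rule vderivI) fact
  then show "(\<forall>t. h differentiable (at t)) \<and> vderiv h \<in> insert f {h. smooth h}"
    if "h \<in> insert f {h. smooth h}" for h
    using that assms smooth_vderiv smooth_differentiable by (auto intro: differentiableI_vector)
qed simp

lemma has_vderiv_lincomb: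
  assumes "smooth f" "smooth g"
  shows "((\<lambda>t. a * f t + b * g t) has_vector_derivative a * vderiv f t + b * vderiv g t) (at t)"
  by (rule derivative_eq_intros smooth_has_vderiv assms refl)+

lemma smooth_lincomb:
  assumes "smooth f" "smooth g"
  shows "smooth (\<lambda>t. a * f t + b * g t)"
proof (rule smooth_coinduct[where P = "{\<lambda>t. a * f t + b * g t | f g. smooth f \<and> smooth g}"])
  show "(\<lambda>t. a * f t + b * g t) \<in> {\<lambda>t. a * f t + b * g t | f g. smooth f \<and> smooth g}"
    using assms by blast
  fix h assume "h \<in> {\<lambda>t. a * f t + b * g t | f g. smooth f \<and> smooth g}"
  then obtain f g where h: "h = (\<lambda>t. a * f t + b * g t)" "smooth f" "smooth g" by blast
  have "vderiv h = (\<lambda>t. a * vderiv f t + b * vderiv g t)"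
    unfolding h(1) by (rule vderivI has_vderiv_lincomb h)+
  then show "(\<forall>t. h differentiable (at t)) \<and>
      vderiv h \<in> {\<lambda>t. a * f t + b * g t | f g. smooth f \<and> smooth g}"
    using h has_vderiv_lincomb[OF h(2,3)] smooth_vderiv
    by (fastforce intro: differentiableI_vector)
qed

lemma has_vector_derivative_exp_mult:
  fixes f :: "real \<Rightarrow> complex"
  assumes "(f has_vector_derivative f') (at t)"
  shows "((\<lambda>t. exp (k * of_real t) * f t) has_vector_derivative
    exp (k * of_real t) * (k * f t + f')) (at t)"
proof -
  have "((\<lambda>t. exp (k * complex_of_real t)) has_vector_derivative k * exp (k * of_real t)) (at t)"
    by (rule has_vector_derivative_real_field) (auto intro!: derivative_eq_intros)
  then have "((\<lambda>t. exp (k * complex_of_real t) * f t) has_vector_derivative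
      (exp (k * of_real t) * f' + k * exp (k * of_real t) * f t)) (at t)"
    by (rule has_vector_derivative_mult) fact
  then show ?thesis by (simp add: algebra_simps)
qed

lemma smooth_exp_mult:
  assumes "smooth f"
  shows "smooth (\<lambda>t. exp (k * of_real t) * f t)"
proof (rule smooth_coinduct[where P = "{\<lambda>t. exp (k * of_real t) * f t | f. smooth f}"])
  show "(\<lambda>t. exp (k * of_real t) * f t) \<in> {\<lambda>t. exp (k * of_real t) * f t | f. smooth f}"
    using assms by blast
  fix h assume "h \<in> {\<lambda>t. exp (k * of_real t) * f t | f. smooth f}"
  then obtain f where h: "h = (\<lambda>t. exp (k * of_real t) * f t)" "smooth f" by blast
  \<comment> \<open>The factor \<open>1\<close> gives the bracket the shape required by
    \<open>smooth_lincomb\<close>.\<close>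
  have d: "(h has_vector_derivative exp (k * of_real t) * (k * f t + 1 * vderiv f t)) (at t)" for t
    using has_vector_derivative_exp_mult[OF smooth_has_vderiv[OF h(2)]] by (simp add: h)
  then have "vderiv h = (\<lambda>t. exp (k * of_real t) * (k * f t + 1 * vderiv f t))"
    by (rule vderivI)
  moreover have "smooth (\<lambda>t. k * f t + 1 * vderiv f t)"
    by (intro smooth_lincomb smooth_vderiv h)
  ultimately show "(\<forall>t. h differentiable (at t)) \<and>
      vderiv h \<in> {\<lambda>t. exp (k * of_real t) * f t | f. smooth f}"
    using d by (auto intro: differentiableI_vector)
qed

lemma has_vector_derivative_shift:
  fixes f :: "real \<Rightarrow> 'a::real_normed_vector"
  assumes "(f has_vector_derivative f') (at (s - t))"
  shows "((\<lambda>s. f (s - t)) has_vector_derivative f') (at s)"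
proof -
  have "((\<lambda>s. s - t) has_vector_derivative 1) (at s)"
    by (auto intro!: derivative_eq_intros)
  from vector_diff_chain_at[OF this assms] show ?thesis by (simp add: o_def)
qed

lemma smooth_shift:
  assumes "smooth f"
  shows "smooth (\<lambda>s. f (s - t))"
proof (rule smooth_coinduct[where P = "{\<lambda>s. f (s - t) | f. smooth f}"])
  show "(\<lambda>s. f (s - t)) \<in> {\<lambda>s. f (s - t) | f. smooth f}"
    using assms by blast
  fix h assume "h \<in> {\<lambda>s. f (s - t) | f. smooth f}"
  then obtain f where h: "h = (\<lambda>s. f (s - t))" "smooth f" by blast
  have d: "(h has_vector_derivative vderiv f (s - t)) (at s)" for s
    unfolding h(1) by (intro has_vector_derivative_shift smooth_has_vderiv h)
  then have "vderiv h = (\<lambda>s. vderiv f (s - t))"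
    by (rule vderivI)
  then show "(\<forall>t. h differentiable (at t)) \<and> vderiv h \<in> {\<lambda>s. f (s - t) | f. smooth f}"
    using d smooth_vderiv[OF h(2)] by (auto intro: differentiableI_vector)
qed

section \<open>Pointwise support conditions and closure properties of test functions\<close>

lemma test_funs_iff: "\<phi> \<in> test_funs \<longleftrightarrow> smooth \<phi> \<and> (\<exists>b. \<forall>t. \<bar>t\<bar> > b \<longrightarrow> \<phi> t = 0)"
proof -
  have "compact (fsupp \<phi>) \<longleftrightarrow> bounded {t. \<phi> t \<noteq> 0}"
    by (simp add: fsupp_def compact_closure)
  also have "\<dots> \<longleftrightarrow> (\<exists>b. \<forall>t. \<bar>t\<bar> > b \<longrightarrow> \<phi> t = 0)"
    unfolding bounded_iff by (auto simp: not_less[symmetric])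
  finally show ?thesis by (simp add: test_funs_def smooth_def)
qed

text \<open>Since \<open>{0..}\<close> is closed, support in it just means vanishing at negative
  points, and compactness then only asks for an upper bound.\<close>

lemma test_funs0_iff:
  "\<phi> \<in> test_funs0 \<longleftrightarrow> smooth \<phi> \<and> (\<forall>t<0. \<phi> t = 0) \<and> (\<exists>b. \<forall>t>b. \<phi> t = 0)"
proof -
  have "fsupp \<phi> \<subseteq> {0..} \<longleftrightarrow> {t. \<phi> t \<noteq> 0} \<subseteq> {0..}"
    unfolding fsupp_def by (meson closed_atLeast closure_minimal closure_subset order_trans)
  also have "\<dots> \<longleftrightarrow> (\<forall>t<0. \<phi> t = 0)"
    by (auto simp: not_less[symmetric])
  finally have 1: "fsupp \<phi> \<subseteq> {0..} \<longleftrightarrow> (\<forall>t<0. \<phi> t = 0)" .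
  have "(\<exists>b. \<forall>t. \<bar>t\<bar> > b \<longrightarrow> \<phi> t = 0) \<longleftrightarrow> (\<exists>b. \<forall>t>b. \<phi> t = 0)" if z: "\<forall>t<0. \<phi> t = 0"
  proof
    assume "\<exists>b. \<forall>t>b. \<phi> t = 0"
    then obtain b where "\<forall>t>b. \<phi> t = 0" ..
    with z have "\<forall>t. \<bar>t\<bar> > b \<longrightarrow> \<phi> t = 0" by (metis abs_of_nonneg not_less)
    then show "\<exists>b. \<forall>t. \<bar>t\<bar> > b \<longrightarrow> \<phi> t = 0" ..
  qed (metis abs_ge_self less_le_trans)
  then show ?thesis unfolding test_funs0_def by (auto simp: 1 test_funs_iff)
qed

lemma test_funs0_imp: "\<phi> \<in> test_funs0 \<Longrightarrow> \<phi> \<in> test_funs"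
  by (simp add: test_funs0_def)

lemma test_funs_smooth: "\<phi> \<in> test_funs \<Longrightarrow> smooth \<phi>"
  by (simp add: test_funs_iff)

lemma vderiv_eq_0:
  assumes "open S" "t \<in> S" "\<And>s. s \<in> S \<Longrightarrow> f s = 0"
  shows "vderiv f t = 0"
proof -
  have "(f has_vector_derivative 0) (at t)"
    by (rule has_vector_derivative_transform_within_open[of "\<lambda>_. 0", OF _ assms(1,2)])
      (use assms(3) in auto)
  then show ?thesis by (simp add: vderiv_def vector_derivative_at)
qed

lemma test_funs_vderiv:
  assumes "\<phi> \<in> test_funs"
  shows "vderiv \<phi> \<in> test_funs"
proof -
  obtain b where b: "\<forall>t. \<bar>t\<bar> > b \<longrightarrow> \<phi> t = 0" using assms by (auto simp: test_funs_iff)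
  have "open {t::real. \<bar>t\<bar> > b}" by (intro open_Collect_less continuous_intros)
  then have "\<forall>t. \<bar>t\<bar> > b \<longrightarrow> vderiv \<phi> t = 0"
    using b vderiv_eq_0[of "{t. \<bar>t\<bar> > b}"] by auto
  then show ?thesis using assms smooth_vderiv by (auto simp: test_funs_iff)
qed

lemma test_funs0_vderiv:
  assumes "\<phi> \<in> test_funs0"
  shows "vderiv \<phi> \<in> test_funs0"
proof -
  obtain b where b: "\<forall>t>b. \<phi> t = 0" and z: "\<forall>t<0. \<phi> t = 0"
    using assms by (auto simp: test_funs0_iff)
  have "\<forall>t>b. vderiv \<phi> t = 0" "\<forall>t<0. vderiv \<phi> t = 0"
    using b z vderiv_eq_0[of "{b<..}" _ \<phi>] vderiv_eq_0[of "{..<0}" _ \<phi>] by auto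
  then show ?thesis using assms smooth_vderiv by (auto simp: test_funs0_iff)
qed

lemma test_funs_lincomb:
  assumes "\<phi> \<in> test_funs" "\<psi> \<in> test_funs"
  shows "(\<lambda>t. a * \<phi> t + b * \<psi> t) \<in> test_funs"
proof -
  obtain p q where "\<forall>t. \<bar>t\<bar> > p \<longrightarrow> \<phi> t = 0" "\<forall>t. \<bar>t\<bar> > q \<longrightarrow> \<psi> t = 0"
    using assms by (auto simp: test_funs_iff)
  then have "\<forall>t. \<bar>t\<bar> > max p q \<longrightarrow> a * \<phi> t + b * \<psi> t = 0" by simp
  then show ?thesis using assms smooth_lincomb by (auto simp: test_funs_iff simp del: max_less_iff_conj)
qed

lemma test_funs0_lincomb:
  assumes "\<phi> \<in> test_funs0" "\<psi> \<in> test_funs0"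
  shows "(\<lambda>t. a * \<phi> t + b * \<psi> t) \<in> test_funs0"
proof -
  have "(\<lambda>t. a * \<phi> t + b * \<psi> t) \<in> test_funs"
    using assms by (simp add: test_funs0_def test_funs_lincomb)
  then show ?thesis using assms
    by (auto simp: test_funs0_iff test_funs_iff) (metis abs_ge_self less_le_trans)
qed

lemma test_funs0_exp_mult:
  assumes "\<phi> \<in> test_funs0"
  shows "(\<lambda>t. exp (k * of_real t) * \<phi> t) \<in> test_funs0"
  using assms smooth_exp_mult by (auto simp: test_funs0_iff)

lemma test_funs0_shift:
  assumes "\<phi> \<in> test_funs0" "t \<ge> 0"
  shows "(\<lambda>s. \<phi> (s - t)) \<in> test_funs0"
proof -
  obtain b where b: "\<forall>t>b. \<phi> t = 0" using assms by (auto simp: test_funs0_iff)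
  then have "\<forall>s>b+t. \<phi> (s - t) = 0" by simp
  then show ?thesis using assms smooth_shift by (auto simp: test_funs0_iff)
qed

lemma vderiv_shift: "smooth f \<Longrightarrow> vderiv (\<lambda>s. f (s - t)) = (\<lambda>s. vderiv f (s - t))"
  by (intro vderivI has_vector_derivative_shift smooth_has_vderiv)

text \<open>Continuity carries the vanishing on the negative axis over to \<open>0\<close>. The
  value at \<open>0\<close> matters later, where it kills the \<open>delta 0\<close> entry of the
  matrix semigroup.\<close>

lemma test_funs0_zero_at_0:
  assumes "\<phi> \<in> test_funs0" "t \<le> 0"
  shows "\<phi> t = 0"
proof -
  have "continuous_on (closure {..<0}) \<phi>"
    using assms by (simp add: test_funs0_iff smooth_continuous)
  then have "\<phi> t = 0" if "t \<in> closure {..<0}" for t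
    by (rule continuous_constant_on_closure) (use assms that in \<open>auto simp: test_funs0_iff\<close>)
  then show ?thesis using assms(2) by (simp add: closure_lessThan)
qed

section \<open>Primitives taken from minus infinity\<close>

lemma has_integral_lower_atMost:
  fixes g :: "real \<Rightarrow> complex"
  assumes "continuous_on UNIV g" "\<And>s. s \<le> a \<Longrightarrow> g s = 0"
  shows "(g has_integral integral {a..s} g) {..s}"
proof -
  have "(g has_integral integral {a..s} g) {a..s}"
    using assms by (intro integrable_integral integrable_continuous_interval)
      (auto intro: continuous_on_subset)
  moreover have "{x \<in> {a..s} - {..s}. g x \<noteq> 0} = {}" "{x \<in> {..s} - {a..s}. g x \<noteq> 0} = {}"
    using assms(2) by (auto simp: not_le)
  ultimately show ?thesis
    by (subst has_integral_spike_set_eq[of _ "{a..s}"]) (simp_all only: negligible_empty)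
qed

lemma integral_atMost_has_vector_derivative:
  fixes g :: "real \<Rightarrow> complex"
  assumes "continuous_on UNIV g" "\<And>s. s \<le> a \<Longrightarrow> g s = 0"
  shows "((\<lambda>s. integral {..s} g) has_vector_derivative g s) (at s)"
proof -
  \<comment> \<open>Starting at \<open>c\<close> loses nothing because \<open>c \<le> a\<close>, and
    \<open>c < s\<close> puts \<open>s\<close> into the interior of \<open>{c..s+1}\<close>, which
    gives a two-sided derivative.\<close>
  define c where "c = min a (s - 1)"
  have eq: "integral {..y} g = integral {c..y} g" for y
    by (rule integral_unique, rule has_integral_lower_atMost) (use assms c_def in auto)
  have "((\<lambda>y. integral {c..y} g) has_vector_derivative g s) (at s within {c..s+1})"
    by (rule integral_has_vector_derivative)
      (use assms c_def in \<open>auto intro: continuous_on_subset\<close>)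
  then have "((\<lambda>y. integral {c..y} g) has_vector_derivative g s) (at s)"
    by (subst (asm) at_within_interior) (auto simp: c_def interior_atLeastAtMost_real)
  then show ?thesis unfolding eq .
qed

lemma integral_atMost_eq_0:
  fixes g :: "real \<Rightarrow> complex"
  assumes "\<And>s. s \<le> a \<Longrightarrow> g s = 0" "s \<le> a"
  shows "integral {..s} g = 0"
  by (rule integral_unique, rule has_integral_is_0) (use assms in auto)

text \<open>Meant for a second primitive: the first one is constant beyond the support of a test
  function, so the second grows linearly there.\<close>

lemma vector_derivative_eq_imp_affine:
  fixes F :: "real \<Rightarrow> complex"
  assumes "\<And>s. (F has_vector_derivative f s) (at s)" "\<And>s. s \<ge> b \<Longrightarrow> f s = c" "s \<ge> b"
  shows "F s = F b + of_real (s - b) * c"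
proof -
  have "((\<lambda>_. c) has_integral (F s - F b)) {b..s}"
    by (rule fundamental_theorem_of_calculus)
      (use assms in \<open>auto intro: has_vector_derivative_at_within simp flip: assms(2)\<close>)
  moreover have "((\<lambda>_. c) has_integral (s - b) *\<^sub>R c) {b..s}"
    using has_integral_const_real[of c b s] assms(3) by simp
  ultimately have "F s - F b = (s - b) *\<^sub>R c" by (rule has_integral_unique)
  then show ?thesis by (simp add: scaleR_conv_of_real algebra_simps)
qed

lemma integral_atMost_eq_UNIV:
  fixes g :: "real \<Rightarrow> complex"
  assumes "\<And>t. t > s \<Longrightarrow> g t = 0"
  shows "integral {..s} g = integral UNIV g"
proof -
  have "{x \<in> {..s} - UNIV. g x \<noteq> 0} = {}" "{x \<in> UNIV - {..s}. g x \<noteq> 0} = {}"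
    using assms by (auto simp: not_le)
  then show ?thesis
    by (intro integral_spike_set) (simp_all only: negligible_empty)
qed

lemma test_funs_integrable:
  assumes "\<phi> \<in> test_funs"
  shows "\<phi> integrable_on UNIV" "\<phi> integrable_on {..s}"
proof -
  obtain b where b: "\<forall>t. \<bar>t\<bar> > b \<longrightarrow> \<phi> t = 0" using assms by (auto simp: test_funs_iff)
  \<comment> \<open>The extra \<open>1\<close> turns \<open>t \<le> -b-1\<close> into the strict
    inequality \<open>\<bar>t\<bar> > b\<close>, whatever the sign of \<open>b\<close>.\<close>
  have z: "\<phi> t = 0" if "t \<le> -b-1" for t using b that by auto
  have *: "(\<phi> has_integral integral {-b-1..s} \<phi>) {..s}" for s
    using z assms by (intro has_integral_lower_atMost) (auto simp: test_funs_smooth smooth_continuous)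
  then show "\<phi> integrable_on {..s}" by blast
  have "{x \<in> {..b} - UNIV. \<phi> x \<noteq> 0} = {}" "{x \<in> UNIV - {..b}. \<phi> x \<noteq> 0} = {}"
    using b by (auto simp: not_le)
  then show "\<phi> integrable_on UNIV"
    using *[of b] has_integral_spike_set_eq[where S = "{..b}" and T = UNIV and f = \<phi>]
    by (metis negligible_empty integrable_on_def)
qed

lemma test_funs_integral_has_vderiv:
  assumes "\<phi> \<in> test_funs"
  shows "((\<lambda>s. integral {..s} \<phi>) has_vector_derivative \<phi> s) (at s)"
proof -
  obtain b where b: "\<forall>t. \<bar>t\<bar> > b \<longrightarrow> \<phi> t = 0" using assms by (auto simp: test_funs_iff)
  have z: "\<phi> t = 0" if "t \<le> -b-1" for t using b that by auto
  with assms show ?thesis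
    by (intro integral_atMost_has_vector_derivative) (auto simp: test_funs_smooth smooth_continuous)
qed

text \<open>Mean zero is what makes the primitive vanish again to the right of the support.\<close>

lemma test_funs_integral:
  assumes \<phi>: "\<phi> \<in> test_funs" and "integral UNIV \<phi> = 0"
  shows "(\<lambda>s. integral {..s} \<phi>) \<in> test_funs"
proof -
  obtain b where b: "\<forall>t. \<bar>t\<bar> > b \<longrightarrow> \<phi> t = 0" using \<phi> by (auto simp: test_funs_iff)
  have "integral {..s} \<phi> = 0" if "\<bar>s\<bar> > b" for s
  proof (cases "s > 0")
    case True
    then have "integral {..s} \<phi> = integral UNIV \<phi>"
      using b that by (intro integral_atMost_eq_UNIV) auto
    then show ?thesis using assms by simp
  next
    case False
    then show ?thesis using b that by (intro integral_atMost_eq_0[of s]) auto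
  qed
  moreover have "smooth (\<lambda>s. integral {..s} \<phi>)"
    using smoothI[OF test_funs_integral_has_vderiv test_funs_smooth] \<phi> by blast
  ultimately show ?thesis by (auto simp: test_funs_iff)
qed

lemma test_funs_integral_vderiv:
  assumes "\<phi> \<in> test_funs"
  shows "integral {..s} (vderiv \<phi>) = \<phi> s"
proof -
  obtain b where b: "\<forall>t. \<bar>t\<bar> > b \<longrightarrow> \<phi> t = 0" using assms by (auto simp: test_funs_iff)
  obtain c where c: "\<forall>t. \<bar>t\<bar> > c \<longrightarrow> vderiv \<phi> t = 0"
    using test_funs_vderiv[OF assms] by (auto simp: test_funs_iff)
  \<comment> \<open>A starting point to the left of \<open>s\<close> and of the supports of both
    \<open>\<phi>\<close> and its derivative.\<close>
  define a where "a = min s (-\<bar>b\<bar>-\<bar>c\<bar>-1)"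
  have "(vderiv \<phi> has_integral \<phi> s - \<phi> a) {a..s}"
    by (rule fundamental_theorem_of_calculus)
      (auto simp: a_def intro!: has_vector_derivative_at_within smooth_has_vderiv test_funs_smooth assms)
  moreover have "\<phi> a = 0" using b by (auto simp: a_def)
  moreover have "integral {..s} (vderiv \<phi>) = integral {a..s} (vderiv \<phi>)"
  proof (rule integral_unique, rule has_integral_lower_atMost)
    show "continuous_on UNIV (vderiv \<phi>)"
      by (intro smooth_continuous smooth_vderiv test_funs_smooth assms)
  qed (use c in \<open>auto simp: a_def\<close>)
  ultimately show ?thesis by auto
qed

lemma test_funs_integral_UNIV_vderiv:
  assumes "\<phi> \<in> test_funs"
  shows "integral UNIV (vderiv \<phi>) = 0"
proof -
  obtain b where b: "\<forall>t. \<bar>t\<bar> > b \<longrightarrow> \<phi> t = 0" using assms by (auto simp: test_funs_iff)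
  obtain c where c: "\<forall>t. \<bar>t\<bar> > c \<longrightarrow> vderiv \<phi> t = 0"
    using test_funs_vderiv[OF assms] by (auto simp: test_funs_iff)
  have "integral UNIV (vderiv \<phi>) = integral {..\<bar>b\<bar>+\<bar>c\<bar>+1} (vderiv \<phi>)"
    by (rule integral_atMost_eq_UNIV[symmetric]) (use c in auto)
  also have "\<dots> = 0" using b by (simp add: test_funs_integral_vderiv[OF assms])
  finally show ?thesis .
qed

lemma test_funs0I:
  assumes "\<And>s. (F has_vector_derivative g s) (at s)" "smooth g"
    "\<And>s. s < 0 \<Longrightarrow> F s = 0" "\<And>s. s > b \<Longrightarrow> F s = 0"
  shows "F \<in> test_funs0"
  using smoothI[OF assms(1,2)] assms(3,4) by (auto simp: test_funs0_iff)

section \<open>Linear functionals on test functions under translation\<close>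

text \<open>With \<open>\<psi> = (\<lambda>s. \<integral>\<^bsub>0\<^esub>\<^bsup>t\<^esup> exp (k * (t - r)) * \<phi> (s - r) dr)\<close> one has
  \<open>\<psi>' + k \<psi> = exp (k * t) \<phi> - \<phi> (\<sqdot> - t)\<close>, which settles the claim without using continuity of
  \<open>L\<close>.\<close>

lemma linear_functional_shift:
  fixes L :: "(real \<Rightarrow> complex) \<Rightarrow> 'e::complex_normed_vector"
  assumes lin: "\<And>\<phi> \<psi> a b. \<phi> \<in> test_funs0 \<Longrightarrow> \<psi> \<in> test_funs0 \<Longrightarrow>
      L (\<lambda>t. a * \<phi> t + b * \<psi> t) = a *\<^sub>C L \<phi> + b *\<^sub>C L \<psi>"
    and L: "\<And>\<phi>. \<phi> \<in> test_funs0 \<Longrightarrow> L (vderiv \<phi>) = - k *\<^sub>C L \<phi>"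
    and \<phi>: "\<phi> \<in> test_funs0" and t: "t \<ge> 0"
  shows "L (\<lambda>s. \<phi> (s - t)) = exp (k * of_real t) *\<^sub>C L \<phi>"
proof -
  \<comment> \<open>The integrating factor \<open>exp (k * s)\<close> turns the equation for
    \<open>\<psi>\<close> into a plain primitive.\<close>
  define h where "h = (\<lambda>s. exp (k * of_real s) * \<phi> s)"
  have h: "h \<in> test_funs0" unfolding h_def by (rule test_funs0_exp_mult) fact
  define H where "H = (\<lambda>s. integral {..s} h)"
  have H': "(H has_vector_derivative h s) (at s)" for s
    unfolding H_def by (intro test_funs_integral_has_vderiv test_funs0_imp h)
  have H0: "H s = 0" if "s \<le> 0" for s
    unfolding H_def by (rule integral_atMost_eq_0[of 0]) (use that test_funs0_zero_at_0[OF h] in auto)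
  obtain b where b: "\<forall>s>b. h s = 0" using h by (auto simp: test_funs0_iff)
  have Hb: "H s = integral UNIV h" if "s \<ge> b" for s
    unfolding H_def by (rule integral_atMost_eq_UNIV) (use that b in auto)
  \<comment> \<open>This is \<open>exp (k * s)\<close> times the right-hand side
    \<open>exp (k * t) * \<phi> s - \<phi> (s - t)\<close>, rewritten through
    \<open>h\<close>.\<close>
  define g where "g = (\<lambda>s. exp (k * of_real t) * h s + - exp (k * of_real t) * h (s - t))"
  have g: "g \<in> test_funs0"
    unfolding g_def by (intro test_funs0_lincomb test_funs0_shift h t)
  define G where "G = (\<lambda>s. exp (k * of_real t) * H s + - exp (k * of_real t) * H (s - t))"
  have G': "(G has_vector_derivative g s) (at s)" for s
    unfolding G_def g_def
    by (intro has_vector_derivative_add has_vector_derivative_mult_right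
        has_vector_derivative_shift H')
  \<comment> \<open>Beyond \<open>b + t\<close> both \<open>H s\<close> and \<open>H (s - t)\<close>
    equal the full integral of \<open>h\<close>, so they cancel and the support is compact.\<close>
  have G: "G \<in> test_funs0"
    by (rule test_funs0I[OF G', where b = "b + t"])
      (use g t in \<open>auto simp: G_def H0 Hb test_funs0_iff\<close>)
  define \<psi> where "\<psi> = (\<lambda>s. exp (- k * of_real s) * G s)"
  have \<psi>: "\<psi> \<in> test_funs0" unfolding \<psi>_def by (rule test_funs0_exp_mult[OF G])
  have "(\<psi> has_vector_derivative exp (- k * of_real s) * (- k * G s + g s)) (at s)" for s
    unfolding \<psi>_def by (intro has_vector_derivative_exp_mult G')
  then have "vderiv \<psi> = (\<lambda>s. exp (- k * of_real s) * (- k * G s + g s))"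
    by (rule vderivI)
  then have eq: "(\<lambda>s. 1 * vderiv \<psi> s + k * \<psi> s) = (\<lambda>s. exp (k * of_real t) * \<phi> s + - 1 * \<phi> (s - t))"
    by (simp add: \<psi>_def g_def h_def fun_eq_iff algebra_simps exp_minus exp_diff)
  have "L (\<lambda>s. 1 * vderiv \<psi> s + k * \<psi> s) = 1 *\<^sub>C L (vderiv \<psi>) + k *\<^sub>C L \<psi>"
    by (intro lin test_funs0_vderiv \<psi>)
  also have "\<dots> = 0" by (simp add: L[OF \<psi>] scaleC_one)
  finally have "L (\<lambda>s. exp (k * of_real t) * \<phi> s + - 1 * \<phi> (s - t)) = 0" unfolding eq .
  then show ?thesis
    by (subst (asm) lin) (auto simp: scaleC_one \<phi> test_funs0_shift t)
qed

text \<open>The second derivative of \<open>\<psi> = (\<lambda>s. \<integral>\<^bsub>0\<^esub>\<^bsup>t\<^esup> (t - r) * \<phi> (s - r) dr)\<close> is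
  \<open>\<phi> (\<sqdot> - t) + t \<phi>' - \<phi>\<close>.\<close>

lemma linear_functional_shift_nilpotent:
  fixes L :: "(real \<Rightarrow> complex) \<Rightarrow> 'e::complex_normed_vector"
  assumes lin: "\<And>\<phi> \<psi> a b. \<phi> \<in> test_funs0 \<Longrightarrow> \<psi> \<in> test_funs0 \<Longrightarrow>
      L (\<lambda>t. a * \<phi> t + b * \<psi> t) = a *\<^sub>C L \<phi> + b *\<^sub>C L \<psi>"
    and L: "\<And>\<phi>. \<phi> \<in> test_funs0 \<Longrightarrow> L (vderiv (vderiv \<phi>)) = 0"
    and \<phi>: "\<phi> \<in> test_funs0" and t: "t \<ge> 0"
  shows "L (\<lambda>s. \<phi> (s - t)) = L \<phi> - of_real t *\<^sub>C L (vderiv \<phi>)"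
proof -
  define F where "F = (\<lambda>s. integral {..s} \<phi>)"
  define FF where "FF = (\<lambda>s. integral {..s} F)"
  obtain b where b: "\<forall>s>b. \<phi> s = 0" using \<phi> by (auto simp: test_funs0_iff)
  have F': "(F has_vector_derivative \<phi> s) (at s)" for s
    unfolding F_def by (intro test_funs_integral_has_vderiv test_funs0_imp \<phi>)
  have F0: "F s = 0" if "s \<le> 0" for s
    unfolding F_def by (rule integral_atMost_eq_0[of 0]) (use that test_funs0_zero_at_0[OF \<phi>] in auto)
  have Fb: "F s = integral UNIV \<phi>" if "s \<ge> b" for s
    unfolding F_def by (rule integral_atMost_eq_UNIV) (use that b in auto)
  have F: "smooth F" by (rule smoothI[OF F']) (use \<phi> in \<open>simp add: test_funs0_iff\<close>)
  have FF': "(FF has_vector_derivative F s) (at s)" for s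
    unfolding FF_def by (rule integral_atMost_has_vector_derivative[of _ 0])
      (use F0 F in \<open>auto simp: smooth_continuous\<close>)
  have FF0: "FF s = 0" if "s \<le> 0" for s
    unfolding FF_def by (rule integral_atMost_eq_0[of 0]) (use that F0 in auto)
  have FFb: "FF s = FF b + of_real (s - b) * integral UNIV \<phi>" if "s \<ge> b" for s
    by (rule vector_derivative_eq_imp_affine[OF FF' Fb]) (use that in auto)
  define \<eta> where "\<eta> = (\<lambda>s. of_real t * \<phi> s - F s + F (s - t))"
  \<comment> \<open>Integrating by parts twice over, the integral of
    \<open>(t - r) * \<phi> (s - r)\<close> becomes this expression in the primitives
    \<open>F\<close> and \<open>FF\<close>.\<close>
  define \<psi> where "\<psi> = (\<lambda>s. of_real t * F s - FF s + FF (s - t))"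
  have \<psi>': "(\<psi> has_vector_derivative \<eta> s) (at s)" for s
    unfolding \<psi>_def \<eta>_def
    by (intro has_vector_derivative_add has_vector_derivative_diff has_vector_derivative_mult_right
        has_vector_derivative_shift F' FF')
  have \<eta>': "(\<eta> has_vector_derivative of_real t * vderiv \<phi> s - \<phi> s + \<phi> (s - t)) (at s)" for s
    unfolding \<eta>_def
    by (intro has_vector_derivative_add has_vector_derivative_diff has_vector_derivative_mult_right
        has_vector_derivative_shift F' smooth_has_vderiv test_funs_smooth test_funs0_imp \<phi>)
  \<comment> \<open>The second derivative has three terms while \<open>lin\<close> takes two, so it
    is assembled in two stages.\<close>
  define r\<^sub>0 where "r\<^sub>0 = (\<lambda>s. 1 * \<phi> (s - t) + - 1 * \<phi> s)"
  have r\<^sub>0: "r\<^sub>0 \<in> test_funs0" "L r\<^sub>0 = 1 *\<^sub>C L (\<lambda>s. \<phi> (s - t)) + (- 1) *\<^sub>C L \<phi>"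
    unfolding r\<^sub>0_def by (intro test_funs0_lincomb lin test_funs0_shift \<phi> t)+
  define r where "r = (\<lambda>s. of_real t * vderiv \<phi> s + 1 * r\<^sub>0 s)"
  have r: "r \<in> test_funs0" "L r = of_real t *\<^sub>C L (vderiv \<phi>) + 1 *\<^sub>C L r\<^sub>0"
    unfolding r_def by (intro test_funs0_lincomb lin test_funs0_vderiv \<phi> r\<^sub>0)+
  have \<eta>'': "(\<eta> has_vector_derivative r s) (at s)" for s
    using \<eta>'[of s] by (simp add: r_def r\<^sub>0_def algebra_simps)
  have "smooth \<eta>" by (rule smoothI[OF \<eta>'']) (use r in \<open>simp add: test_funs0_iff\<close>)
  moreover have "\<psi> s = 0" if "s < 0" for s
    using that t by (simp add: \<psi>_def F0 FF0)
  \<comment> \<open>Here \<open>FF\<close> is affine with slope the integral of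
    \<open>\<phi>\<close>, so \<open>FF s - FF (s - t)\<close> is exactly
    \<open>t * F s\<close>.\<close>
  moreover have "\<psi> s = 0" if "s > b + t" for s
  proof -
    have "FF s = FF b + of_real (s - b) * integral UNIV \<phi>"
      "FF (s - t) = FF b + of_real (s - t - b) * integral UNIV \<phi>"
      by (rule FFb; use that t in simp)+
    then have "FF s - FF (s - t) = of_real t * integral UNIV \<phi>"
      by (simp only: of_real_diff) (simp add: algebra_simps)
    then show ?thesis using that t by (simp add: \<psi>_def Fb algebra_simps)
  qed
  ultimately have "\<psi> \<in> test_funs0"
    by (rule test_funs0I[OF \<psi>'])
  then have "L (vderiv (vderiv \<psi>)) = 0" by (rule L)
  also have "vderiv (vderiv \<psi>) = r" unfolding vderivI[OF \<psi>'] by (rule vderivI[OF \<eta>''])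
  also note r(2)
  finally show ?thesis by (simp add: r\<^sub>0 scaleC_one algebra_simps)
qed

section \<open>Translation of functionals satisfying a second-order eigenvalue equation\<close>

definition cosC :: "real \<Rightarrow> real \<Rightarrow> complex"
  where "cosC m t = of_real (cos (m * t))"

text \<open>The solution of \<open>y'' = - m\<^sup>2 * y\<close> with \<open>y 0 = 0\<close> and
  \<open>y' 0 = 1\<close>; the case \<open>m = 0\<close> is the limit of the other.\<close>

definition sinC :: "real \<Rightarrow> real \<Rightarrow> complex"
  where "sinC m t = of_real (if m = 0 then t else sin (m * t) / m)"

text \<open>The exponential rule for both roots \<open>\<plusminus> \<i> * m\<close> gives two
  linear equations for the values of \<open>L\<close> at the translate and at its derivative; their
  difference eliminates the latter. For \<open>m = 0\<close> the roots coincide and the nilpotent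
  rule takes over.\<close>

lemma linear_functional_shift_cos:
  fixes L :: "(real \<Rightarrow> complex) \<Rightarrow> 'e::complex_normed_vector"
  assumes lin: "\<And>\<phi> \<psi> a b. \<phi> \<in> test_funs0 \<Longrightarrow> \<psi> \<in> test_funs0 \<Longrightarrow>
      L (\<lambda>t. a * \<phi> t + b * \<psi> t) = a *\<^sub>C L \<phi> + b *\<^sub>C L \<psi>"
    and L: "\<And>\<phi>. \<phi> \<in> test_funs0 \<Longrightarrow> L (vderiv (vderiv \<phi>)) = - of_real (m\<^sup>2) *\<^sub>C L \<phi>"
    and \<phi>: "\<phi> \<in> test_funs0" and t: "t \<ge> 0"
  shows "L (\<lambda>s. \<phi> (s - t)) = cosC m t *\<^sub>C L \<phi> - sinC m t *\<^sub>C L (vderiv \<phi>)"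
proof (cases "m = 0")
  case True
  then have "L (\<lambda>s. \<phi> (s - t)) = L \<phi> - of_real t *\<^sub>C L (vderiv \<phi>)"
    using L by (intro linear_functional_shift_nilpotent lin \<phi> t) auto
  then show ?thesis by (simp add: True cosC_def sinC_def scaleC_one)
next
  case False
  txt \<open>As \<open>\<partial>\<^sup>2 + m\<^sup>2 = (\<partial> - k) (\<partial> + k)\<close>, the functional \<open>L \<circ> (\<partial> + k)\<close> is an eigenfunctional
    of \<open>\<partial>\<close>.\<close>
  have *: "L (vderiv (\<lambda>s. \<phi> (s - t))) + k *\<^sub>C L (\<lambda>s. \<phi> (s - t)) =
      exp (- k * of_real t) *\<^sub>C (L (vderiv \<phi>) + k *\<^sub>C L \<phi>)" if k: "k\<^sup>2 = - of_real (m\<^sup>2)" for k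
  proof -
    define M where "M = (\<lambda>\<phi>. L (vderiv \<phi>) + k *\<^sub>C L \<phi>)"
    have "M (\<lambda>s. \<phi> (s - t)) = exp (- k * of_real t) *\<^sub>C M \<phi>"
    proof (rule linear_functional_shift[OF _ _ \<phi> t])
      fix \<phi> \<psi> a b assume h: "\<phi> \<in> test_funs0" "\<psi> \<in> test_funs0"
      then have "vderiv (\<lambda>t. a * \<phi> t + b * \<psi> t) = (\<lambda>t. a * vderiv \<phi> t + b * vderiv \<psi> t)"
        by (intro vderivI has_vderiv_lincomb test_funs_smooth test_funs0_imp)
      then show "M (\<lambda>t. a * \<phi> t + b * \<psi> t) = a *\<^sub>C M \<phi> + b *\<^sub>C M \<psi>"
        using h by (simp add: M_def lin test_funs0_vderiv scaleC_add_right scaleC_scaleC ac_simps)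
    next
      fix \<phi> assume "\<phi> \<in> test_funs0"
      \<comment> \<open>Since \<open>k\<^sup>2 = - m\<^sup>2\<close>, the derivative acts on
        \<open>M\<close> as multiplication by \<open>k\<close>;
        \<open>linear_functional_shift\<close> is thus applied with parameter
        \<open>- k\<close>.\<close>
      then show "M (vderiv \<phi>) = - (- k) *\<^sub>C M \<phi>"
        using k by (simp add: M_def L scaleC_add_right scaleC_scaleC flip: power2_eq_square)
    qed
    then show ?thesis by (simp add: M_def)
  qed
  define X Y where "X = L (\<lambda>s. \<phi> (s - t))" and "Y = L (vderiv (\<lambda>s. \<phi> (s - t)))"
  define p q where "p = exp (- (\<i> * of_real m) * complex_of_real t)"
    and "q = exp (\<i> * of_real m * complex_of_real t)"
  have 1: "Y + (\<i> * of_real m) *\<^sub>C X = p *\<^sub>C (L (vderiv \<phi>) + (\<i> * of_real m) *\<^sub>C L \<phi>)"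
    unfolding X_def Y_def p_def by (rule *) (simp add: power_mult_distrib)
  have 2: "Y + (-(\<i> * of_real m)) *\<^sub>C X = q *\<^sub>C (L (vderiv \<phi>) + (-(\<i> * of_real m)) *\<^sub>C L \<phi>)"
    using *[of "-(\<i> * of_real m)"] unfolding X_def Y_def q_def by (simp add: power_mult_distrib)
  have pq: "p = cos (m * t) - \<i> * sin (m * t)" "q = cos (m * t) + \<i> * sin (m * t)"
    unfolding p_def q_def by (simp_all add: complex_eq_iff Re_exp Im_exp)
  have "(2 * \<i> * of_real m) *\<^sub>C X = (Y + (\<i> * of_real m) *\<^sub>C X) - (Y + (-(\<i> * of_real m)) *\<^sub>C X)"
    by (simp add: scaleC_add_left[symmetric])
  also have "\<dots> = (p - q) *\<^sub>C L (vderiv \<phi>) + ((p + q) * (\<i> * of_real m)) *\<^sub>C L \<phi>"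
    unfolding 1 2 by (simp add: scaleC_add_right scaleC_scaleC complex_vector.scale_left_diff_distrib
        complex_vector.scale_right_diff_distrib scaleC_add_left distrib_right)
  also have "\<dots> = (2 * \<i> * of_real m) *\<^sub>C (cosC m t *\<^sub>C L \<phi> - sinC m t *\<^sub>C L (vderiv \<phi>))"
    using False by (simp add: pq cosC_def sinC_def scaleC_scaleC
        complex_vector.scale_right_diff_distrib ac_simps)
  finally show ?thesis
    using False by (simp add: X_def)
qed

section \<open>Almost periodic functions on the line\<close>

text \<open>Bochner's criterion: the translates of \<open>f\<close> are totally bounded in the supremum norm.
  Unlike the definition by relatively dense almost periods it is visibly stable under sums.
  Functions live on the whole line because \<open>T - s\<close> is then an almost period for all \<open>T, s\<close>
  with close translates; on the half-line it would be one only for \<open>t \<ge> s\<close>.\<close>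

definition bohr :: "(real \<Rightarrow> 'a::real_normed_vector) \<Rightarrow> bool"
  where "bohr f \<longleftrightarrow> continuous_on UNIV f \<and>
    (\<forall>\<epsilon>>0. \<exists>F. finite F \<and> (\<forall>T. \<exists>s\<in>F. \<forall>t. norm (f (t + T) - f (t + s)) \<le> \<epsilon>))"

lemma bohr_continuous: "bohr f \<Longrightarrow> continuous_on S f"
  unfolding bohr_def using continuous_on_subset by blast

text \<open>If the translates by \<open>a + M\<close> and by \<open>s\<close> are close, then
  \<open>a + M - s\<close> is an almost period. The finitely many \<open>s\<close> are bounded by
  \<open>M\<close>, so it lies in a window of length \<open>2 * M\<close> starting at
  \<open>a\<close>.\<close>

lemma bohr_almost_periodic:
  assumes "bohr u" "\<And>t. t \<ge> 0 \<Longrightarrow> f t = u t"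
  shows "almost_periodic f"
  unfolding almost_periodic_def
proof (intro conjI allI impI)
  show "continuous_on {0..} f"
    using bohr_continuous[OF assms(1)] by (subst continuous_on_cong[OF refl]) (use assms(2) in auto)
  fix \<epsilon> :: real assume "\<epsilon> > 0"
  then obtain F where F: "finite F" "\<And>T. \<exists>s\<in>F. \<forall>t. norm (u (t + T) - u (t + s)) \<le> \<epsilon>"
    using assms(1) unfolding bohr_def by blast
  obtain M where M: "M > 0" "\<And>s. s \<in> F \<Longrightarrow> \<bar>s\<bar> \<le> M"
    using finite_imp_bounded[OF F(1)] unfolding bounded_pos by auto
  show "\<exists>l>0. \<forall>a\<ge>0. \<exists>\<tau>\<in>{a..a + l}. \<forall>t\<ge>0. norm (f (t + \<tau>) - f t) \<le> \<epsilon>"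
  proof (intro exI[of _ "2 * M"] conjI allI impI)
    fix a :: real assume a: "a \<ge> 0"
    obtain s where s: "s \<in> F" "\<And>t. norm (u (t + (a + M)) - u (t + s)) \<le> \<epsilon>"
      using F(2) by blast
    have "a + M - s \<in> {a..a + 2 * M}" using M(2)[OF s(1)] by auto
    \<comment> \<open>The estimate is used at \<open>t - s\<close>, which may be negative; this is
      where closeness on the whole line enters.\<close>
    moreover have "norm (f (t + (a + M - s)) - f t) \<le> \<epsilon>" if "t \<ge> 0" for t
      using s(2)[of "t - s"] M(2)[OF s(1)] a that by (simp add: assms(2) algebra_simps)
    ultimately show "\<exists>\<tau>\<in>{a..a + 2 * M}. \<forall>t\<ge>0. norm (f (t + \<tau>) - f t) \<le> \<epsilon>" by blast
  qed (use M in simp)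
qed

text \<open>The representatives \<open>p\<close> for \<open>f\<close> and \<open>q\<close> for
  \<open>g\<close> may differ, so each pair that occurs together is given one common translate.
  Passing through \<open>p\<close> and \<open>q\<close> costs two quarters of
  \<open>\<epsilon>\<close> for each summand.\<close>

lemma bohr_add:
  assumes f: "bohr f" and g: "bohr g"
  shows "bohr (\<lambda>t. f t + g t)"
  unfolding bohr_def
proof (intro conjI allI impI)
  show "continuous_on UNIV (\<lambda>t. f t + g t)"
    by (intro continuous_intros bohr_continuous f g)
  fix \<epsilon> :: real assume "\<epsilon> > 0"
  then have "\<epsilon> / 4 > 0" by simp
  then obtain F K where F: "finite F" "\<And>T. \<exists>p\<in>F. \<forall>t. norm (f (t + T) - f (t + p)) \<le> \<epsilon> / 4"
    and K: "finite K" "\<And>T. \<exists>q\<in>K. \<forall>t. norm (g (t + T) - g (t + q)) \<le> \<epsilon> / 4"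
    using f g unfolding bohr_def by meson
  define Q where "Q p q T \<longleftrightarrow> (\<forall>t. norm (f (t + T) - f (t + p)) \<le> \<epsilon> / 4) \<and>
    (\<forall>t. norm (g (t + T) - g (t + q)) \<le> \<epsilon> / 4)" for p q T
  \<comment> \<open>For a pair that no \<open>T\<close> realises the choice is arbitrary, but such a
    pair is never selected below.\<close>
  define c where "c = (\<lambda>(p, q). SOME T. Q p q T)"
  show "\<exists>F. finite F \<and> (\<forall>T. \<exists>s\<in>F. \<forall>t. norm (f (t + T) + g (t + T) - (f (t + s) + g (t + s))) \<le> \<epsilon>)"
  proof (intro exI[of _ "c ` (F \<times> K)"] conjI allI)
    fix T
    obtain p q where pq: "p \<in> F" "q \<in> K" and T: "Q p q T"
      using F(2)[of T] K(2)[of T] unfolding Q_def by blast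
    then have c: "Q p q (c (p, q))" unfolding c_def by (auto intro: someI)
    have "norm (f (t + T) + g (t + T) - (f (t + c (p, q)) + g (t + c (p, q)))) \<le> \<epsilon>" for t
    proof -
      have "f (t + T) + g (t + T) - (f (t + c (p, q)) + g (t + c (p, q))) =
        (f (t + T) - f (t + p)) - (f (t + c (p, q)) - f (t + p)) +
        ((g (t + T) - g (t + q)) - (g (t + c (p, q)) - g (t + q)))"
        by simp
      also have "norm \<dots> \<le> (\<epsilon> / 4 + \<epsilon> / 4) + (\<epsilon> / 4 + \<epsilon> / 4)"
        by (rule norm_triangle_mono; rule norm_triangle_le_diff; rule add_mono)
          (use T c in \<open>unfold Q_def, blast+\<close>)
      finally show ?thesis by simp
    qed
    then show "\<exists>s\<in>c ` (F \<times> K). \<forall>t. norm (f (t + T) + g (t + T) - (f (t + s) + g (t + s))) \<le> \<epsilon>"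
      using pq by blast
  qed (use F K in auto)
qed

lemma bohr_bounded_linear:
  assumes h: "bounded_linear h" and f: "bohr f"
  shows "bohr (\<lambda>t. h (f t))"
  unfolding bohr_def
proof (intro conjI allI impI)
  show "continuous_on UNIV (\<lambda>t. h (f t))"
    by (intro bounded_linear.continuous_on[OF h] bohr_continuous f)
  fix \<epsilon> :: real assume \<epsilon>: "\<epsilon> > 0"
  obtain M where M: "M > 0" "\<And>x. norm (h x) \<le> norm x * M"
    using bounded_linear.pos_bounded[OF h] by blast
  have "\<epsilon> / M > 0" using \<epsilon> M by simp
  then obtain F where F: "finite F" "\<And>T. \<exists>s\<in>F. \<forall>t. norm (f (t + T) - f (t + s)) \<le> \<epsilon> / M"
    using f unfolding bohr_def by blast
  have "norm (h (f p) - h (f q)) \<le> \<epsilon>" if "norm (f p - f q) \<le> \<epsilon> / M" for p q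
  proof -
    have "norm (h (f p) - h (f q)) \<le> norm (f p - f q) * M"
      using M(2) by (simp flip: linear_diff[OF bounded_linear.linear[OF h]])
    also have "\<dots> \<le> \<epsilon>" using that M(1) by (simp add: field_simps)
    finally show ?thesis .
  qed
  then show "\<exists>F. finite F \<and> (\<forall>T. \<exists>s\<in>F. \<forall>t. norm (h (f (t + T)) - h (f (t + s))) \<le> \<epsilon>)"
    using F by meson
qed

lemma bounded_linear_scaleC_left: "bounded_linear (\<lambda>a. a *\<^sub>C (x :: 'a::complex_normed_vector))"
proof (rule bounded_linear_intro[where K = "norm x"])
  fix r :: real and a :: complex
  show "(r *\<^sub>R a) *\<^sub>C x = r *\<^sub>R (a *\<^sub>C x)"
    by (simp add: scaleR_conv_of_real scaleC_of_real flip: scaleC_scaleC)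
qed (simp_all add: scaleC_add_left norm_scaleC)

lemmas bohr_scaleC = bohr_bounded_linear[OF bounded_linear_scaleC]
lemmas bohr_scaleC_left = bohr_bounded_linear[OF bounded_linear_scaleC_left]

text \<open>Translating a character multiplies it by a number of modulus one, so total boundedness
  of its translates comes from compactness of the unit circle.\<close>

lemma bohr_cis: "bohr (\<lambda>t. cis (r * t))"
  unfolding bohr_def
proof (intro conjI allI impI)
  show "continuous_on UNIV (\<lambda>t. cis (r * t))" by (intro continuous_intros)
  fix \<epsilon> :: real assume "\<epsilon> > 0"
  then have "\<epsilon> / 2 > 0" by simp
  then obtain k where k: "finite k" "sphere (0::complex) 1 \<subseteq> (\<Union>z\<in>k. ball z (\<epsilon> / 2))"
    using compact_sphere[of "0::complex" 1] unfolding compact_eq_totally_bounded by blast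
  \<comment> \<open>The centre \<open>z\<close> need not be a value of the character, so a translate
    is chosen whose value lies in the ball around \<open>z\<close>.\<close>
  define c where "c z = (SOME T. cis (r * T) \<in> ball z (\<epsilon> / 2))" for z
  show "\<exists>F. finite F \<and> (\<forall>T. \<exists>s\<in>F. \<forall>t. norm (cis (r * (t + T)) - cis (r * (t + s))) \<le> \<epsilon>)"
  proof (intro exI[of _ "c ` k"] conjI allI)
    fix T
    have "cis (r * T) \<in> sphere 0 1" by simp
    then obtain z where z: "z \<in> k" "cis (r * T) \<in> ball z (\<epsilon> / 2)" using k(2) by blast
    then have "cis (r * c z) \<in> ball z (\<epsilon> / 2)" unfolding c_def by (intro someI)
    with z(2) have d: "dist (cis (r * T)) (cis (r * c z)) \<le> \<epsilon>"
      by (metis dist_commute dist_triangle_half_r less_imp_le mem_ball)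
    have "norm (cis (r * (t + T)) - cis (r * (t + c z))) \<le> \<epsilon>" for t
    proof -
      have "cis (r * (t + T)) - cis (r * (t + c z)) = cis (r * t) * (cis (r * T) - cis (r * c z))"
        by (simp add: algebra_simps cis_mult)
      then show ?thesis using d by (simp add: norm_mult dist_norm)
    qed
    then show "\<exists>s\<in>c ` k. \<forall>t. norm (cis (r * (t + T)) - cis (r * (t + s))) \<le> \<epsilon>"
      using z(1) by blast
  qed (use k in simp)
qed

lemma bohr_const: "bohr (\<lambda>_. x)"
  unfolding bohr_def by (auto intro!: exI[of _ "{0}"])

lemma bohr_cmult: "bohr f \<Longrightarrow> bohr (\<lambda>t. c * f t :: complex)"
  by (rule bohr_bounded_linear[OF bounded_linear_mult_right])

lemma bohr_cosC: "bohr (cosC m)"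
proof -
  have "cosC m = (\<lambda>t. 1 / 2 * cis (m * t) + 1 / 2 * cis (- m * t))"
    by (auto simp: cosC_def complex_eq_iff)
  then show ?thesis by (simp only: bohr_add bohr_cmult bohr_cis)
qed

text \<open>Euler's formula writes it as a sum of two characters. For \<open>m = 0\<close> it would
  be the unbounded function \<open>t\<close>.\<close>

lemma bohr_sinC:
  assumes "m \<noteq> 0"
  shows "bohr (sinC m)"
proof -
  have "sinC m = (\<lambda>t. 1 / (2 * \<i> * m) * cis (m * t) + - 1 / (2 * \<i> * m) * cis (- m * t))"
    using assms by (auto simp: sinC_def complex_eq_iff Re_divide Im_divide field_simps power2_eq_square)
  then show ?thesis by (simp only: bohr_add bohr_cmult bohr_cis)
qed

section \<open>Explicit single and double integrals of the scalar orbits\<close>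

lemma cosC_has_integral:
  assumes "t \<ge> 0"
  shows "(cosC m has_integral sinC m t) {0..t}"
proof -
  have "((\<lambda>s. if m = 0 then s else sin (m * s) / m) has_vector_derivative cos (m * s)) (at s within {0..t})" for s
    by (cases "m = 0")
      (auto simp flip: has_real_derivative_iff_has_vector_derivative intro!: derivative_eq_intros)
  from fundamental_theorem_of_calculus[OF assms this]
  have "((\<lambda>s. cos (m * s)) has_integral (if m = 0 then t else sin (m * t) / m)) {0..t}"
    by (simp split: if_splits)
  then show ?thesis
    unfolding cosC_def sinC_def by (rule has_integral_of_real)
qed

lemma cosC_has_integral2:
  assumes "t \<ge> 0"
  shows "((\<lambda>s. (t - s) *\<^sub>R cosC m s) has_integral
    of_real (if m = 0 then t\<^sup>2 / 2 else (1 - cos (m * t)) / m\<^sup>2)) {0..t}"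
proof -
  \<comment> \<open>An antiderivative in \<open>s\<close> of \<open>(t - s) * cos (m * s)\<close>,
    found by parts with \<open>t\<close> held fixed.\<close>
  define F where "F s = (if m = 0 then t * s - s\<^sup>2 / 2 else (t - s) * sin (m * s) / m - cos (m * s) / m\<^sup>2)" for s
  have "(F has_vector_derivative (t - s) * cos (m * s)) (at s within {0..t})" for s
    unfolding F_def
    by (cases "m = 0")
      (auto simp flip: has_real_derivative_iff_has_vector_derivative intro!: derivative_eq_intros
        simp: power2_eq_square field_simps)
  from fundamental_theorem_of_calculus[OF assms this]
  have "((\<lambda>s. (t - s) * cos (m * s)) has_integral F t - F 0) {0..t}" by simp
  moreover have "F t - F 0 = (if m = 0 then t\<^sup>2 / 2 else (1 - cos (m * t)) / m\<^sup>2)"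
    by (simp add: F_def power2_eq_square field_simps)
  ultimately have "((\<lambda>s. (t - s) * cos (m * s)) has_integral
      (if m = 0 then t\<^sup>2 / 2 else (1 - cos (m * t)) / m\<^sup>2)) {0..t}"
    by simp
  from has_integral_of_real[OF this, where 'b = complex]
  have "((\<lambda>s. complex_of_real ((t - s) * cos (m * s))) has_integral
      of_real (if m = 0 then t\<^sup>2 / 2 else (1 - cos (m * t)) / m\<^sup>2)) {0..t}" .
  then show ?thesis
    by (simp add: cosC_def scaleR_conv_of_real)
qed

lemma cis_has_integral:
  assumes "t \<ge> 0"
  shows "((\<lambda>s. cis (r * s)) has_integral (if r = 0 then of_real t else (cis (r * t) - 1) / (\<i> * r))) {0..t}"
proof (cases "r = 0")
  case True
  then show ?thesis using has_integral_const_real[of "1::complex" 0 t] assms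
    by (simp add: scaleR_conv_of_real)
next
  case False
  have "((\<lambda>z. exp (\<i> * r * z) / (\<i> * r)) has_field_derivative exp (\<i> * r * of_real s)) (at (of_real s))" for s
    using False by (auto intro!: derivative_eq_intros)
  then have "((\<lambda>s. exp (\<i> * r * of_real s) / (\<i> * r)) has_vector_derivative exp (\<i> * r * of_real s)) (at s within {0..t})" for s
    by (rule has_vector_derivative_real_field)
  from fundamental_theorem_of_calculus[OF assms this]
  show ?thesis using False by (simp add: cis_conv_exp diff_divide_distrib mult.assoc)
qed

section \<open>Orbits of eigenvectors and their spans\<close>

text \<open>\<open>w\<close> is the kernel \<open>1\<close> or \<open>t - s\<close> of the integrated problem, and \<open>B\<close> is either trivial
  or \<open>bohr\<close>.  The primitive \<open>U\<close> has to be a separate witness because \<open>integral {0..t}\<close> is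
  \<open>0\<close> for \<open>t < 0\<close>.\<close>

definition orbit_in ::
    "((real \<Rightarrow> 'e::complex_banach) \<Rightarrow> bool) \<Rightarrow> (real \<Rightarrow> ('e \<times> 'e) set) \<Rightarrow>
     (real \<Rightarrow> real \<Rightarrow> real) \<Rightarrow> ('e \<times> 'e) set \<Rightarrow> 'e \<Rightarrow> bool"
  where "orbit_in B R w A x \<longleftrightarrow> (\<exists>u U. bohr u \<and> B U \<and> (\<forall>t\<ge>0. (x, u t) \<in> R t \<and>
    ((\<lambda>s. w t s *\<^sub>R u s) has_integral U t) {0..t} \<and> (U t, u t - x) \<in> A))"

text \<open>Every condition in \<open>orbit_in\<close> is linear in \<open>x\<close>,
  \<open>u\<close> and \<open>U\<close> jointly, so witnesses combine as the vectors do. Keeping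
  \<open>B\<close>, \<open>R\<close>, \<open>w\<close> and \<open>A\<close> abstract lets one
  induction serve semigroups and cosine functions, with or without almost periodic
  primitives.\<close>

lemma orbit_in_span:
  fixes R :: "real \<Rightarrow> ('e::complex_banach \<times> 'e) set" and w :: "real \<Rightarrow> real \<Rightarrow> real"
  assumes R: "\<And>t. t \<ge> 0 \<Longrightarrow> csubspace (R t)" and A: "csubspace A"
    and B: "B (\<lambda>_. 0)" "\<And>c f g. B f \<Longrightarrow> B g \<Longrightarrow> B (\<lambda>t. c *\<^sub>C f t + g t)"
    and S: "\<And>x. x \<in> S \<Longrightarrow> orbit_in B R w A x"
    and x: "x \<in> cspan S"
  shows "orbit_in B R w A x"
  using x
proof (induction rule: complex_vector.span_induct_alt)
  case base
  show ?case unfolding orbit_in_def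
    by (rule exI[of _ "\<lambda>_. 0"], rule exI[of _ "\<lambda>_. 0"])
      (use R A B(1) complex_vector.subspace_0 in \<open>auto simp: bohr_const zero_prod_def[symmetric]\<close>)
next
  case (step c x y)
  obtain u U where u: "bohr u" "B U" "\<And>t. t \<ge> 0 \<Longrightarrow> (x, u t) \<in> R t"
    "\<And>t. t \<ge> 0 \<Longrightarrow> ((\<lambda>s. w t s *\<^sub>R u s) has_integral U t) {0..t}"
    "\<And>t. t \<ge> 0 \<Longrightarrow> (U t, u t - x) \<in> A"
    using S[OF step(1)] unfolding orbit_in_def by blast
  obtain v V where v: "bohr v" "B V" "\<And>t. t \<ge> 0 \<Longrightarrow> (y, v t) \<in> R t"
    "\<And>t. t \<ge> 0 \<Longrightarrow> ((\<lambda>s. w t s *\<^sub>R v s) has_integral V t) {0..t}"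
    "\<And>t. t \<ge> 0 \<Longrightarrow> (V t, v t - y) \<in> A"
    using step(2) unfolding orbit_in_def by blast
  have lin: "(c *\<^sub>C p + p', c *\<^sub>C q + q') \<in> X" if "csubspace X" "(p, q) \<in> X" "(p', q') \<in> X"
    for X :: "('e \<times> 'e) set" and p p' q q'
    using complex_vector.subspace_add[OF that(1) complex_vector.subspace_scale[OF that(1,2)] that(3)]
    by (simp add: scaleC_prod_def)
  show ?case unfolding orbit_in_def
  proof (rule exI[of _ "\<lambda>t. c *\<^sub>C u t + v t"], rule exI[of _ "\<lambda>t. c *\<^sub>C U t + V t"], intro conjI allI impI)
    fix t :: real assume t: "t \<ge> 0"
    show "(c *\<^sub>C x + y, c *\<^sub>C u t + v t) \<in> R t" by (intro lin R t u v)
    show "(c *\<^sub>C U t + V t, c *\<^sub>C u t + v t - (c *\<^sub>C x + y)) \<in> A"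
      using lin[OF A u(5)[OF t] v(5)[OF t]]
      by (simp add: complex_vector.scale_right_diff_distrib algebra_simps)
    have "((\<lambda>s. c *\<^sub>C w t s *\<^sub>R u s + w t s *\<^sub>R v s) has_integral c *\<^sub>C U t + V t) {0..t}"
      using has_integral_linear[OF u(4)[OF t] bounded_linear_scaleC]
      by (intro has_integral_add v(4) t) (simp add: o_def)
    then show "((\<lambda>s. w t s *\<^sub>R (c *\<^sub>C u s + v s)) has_integral c *\<^sub>C U t + V t) {0..t}"
      by (simp add: scaleR_add_right linear_scale[OF bounded_linear.linear[OF bounded_linear_scaleC]])
  qed (intro bohr_add bohr_scaleC B u v)+
qed

text \<open>Along an eigenvector all is scalar: when \<open>b t * k = a t - 1\<close>, the required
  pair is \<open>b t\<close> times \<open>(x, k *\<^sub>C x)\<close>, which lies in the subspace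
  \<open>A\<close>.\<close>

lemma orbit_in_eigenvector:
  fixes x :: "'e::complex_banach"
  assumes "csubspace A" "(x, k *\<^sub>C x) \<in> A" "bohr a" "B (\<lambda>t. b t *\<^sub>C x)"
    "\<And>t. t \<ge> 0 \<Longrightarrow> (x, a t *\<^sub>C x) \<in> R t"
    "\<And>t. t \<ge> 0 \<Longrightarrow> ((\<lambda>s. w t s *\<^sub>R a s) has_integral b t) {0..t}"
    "\<And>t. t \<ge> 0 \<Longrightarrow> b t * k = a t - 1"
  shows "orbit_in B R w A x"
  unfolding orbit_in_def
proof (rule exI[of _ "\<lambda>t. a t *\<^sub>C x"], rule exI[of _ "\<lambda>t. b t *\<^sub>C x"], intro conjI allI impI)
  fix t :: real assume t: "t \<ge> 0"
  show "((\<lambda>s. w t s *\<^sub>R a s *\<^sub>C x) has_integral b t *\<^sub>C x) {0..t}"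
    using has_integral_linear[OF assms(6)[OF t] bounded_linear_scaleC_left]
    by (simp add: o_def linear_scale[OF bounded_linear.linear[OF bounded_linear_scaleC_left]])
  have "b t *\<^sub>C (x, k *\<^sub>C x) \<in> A"
    by (intro complex_vector.subspace_scale assms)
  then show "(b t *\<^sub>C x, a t *\<^sub>C x - x) \<in> A"
    by (simp add: scaleC_prod_def scaleC_scaleC assms(7)[OF t] scaleC_one
        complex_vector.scale_left_diff_distrib)
qed (use assms bohr_scaleC_left in auto)

section \<open>Semigroups and cosine functions\<close>

lemma clinear_opsD: "T \<in> clinear_ops \<Longrightarrow> blinfun_apply T (c *\<^sub>C x) = c *\<^sub>C blinfun_apply T x"
  by (simp add: clinear_ops_def)

text \<open>The common shape of the generators and of the operators \<open>dist_op\<close>.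
  Membership in \<open>clinear_ops\<close> supplies complex homogeneity, as \<open>blinfun\<close>
  alone is only real-linear.\<close>

lemma csubspace_eq_graph:
  assumes "\<And>\<phi>. \<phi> \<in> P \<Longrightarrow> S \<phi> \<in> clinear_ops" "\<And>\<phi>. \<phi> \<in> P \<Longrightarrow> T \<phi> \<in> clinear_ops"
  shows "csubspace {(x, y). \<forall>\<phi>\<in>P. blinfun_apply (S \<phi>) x = blinfun_apply (T \<phi>) y}"
  using assms unfolding complex_vector.subspace_def
  by (auto simp: zero_prod_def scaleC_prod_def clinear_opsD blinfun.zero_right blinfun.add_right)

lemma csubspace_dist_op_delta:
  assumes "\<And>\<phi>. \<phi> \<in> test_funs0 \<Longrightarrow> G \<phi> \<in> clinear_ops" "t \<ge> 0"
  shows "csubspace (dist_op G (delta t))"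
  unfolding dist_op_def dist_conv_delta
  by (intro csubspace_eq_graph assms(1) test_funs0_shift assms(2))

text \<open>A trivial common kernel makes the graph single-valued, so the definite description in
  \<open>graph_apply\<close> denotes \<open>y\<close>.\<close>

lemma graph_apply_dist_op:
  assumes "\<And>x. (\<And>\<phi>. \<phi> \<in> test_funs0 \<Longrightarrow> blinfun_apply (G \<phi>) x = 0) \<Longrightarrow> x = 0"
    and "(x, y) \<in> dist_op G T"
  shows "graph_apply (dist_op G T) x = y"
  unfolding graph_apply_def
proof (rule the_equality)
  fix z assume "(x, z) \<in> dist_op G T"
  then have "z - y = 0"
    using assms(2) by - (rule assms(1), auto simp: dist_op_def blinfun.diff_right)
  then show "z = y" by simp
qed fact

lemma op_distributions0_clinear: "G \<in> op_distributions0 \<Longrightarrow> \<phi> \<in> test_funs \<Longrightarrow> G \<phi> \<in> clinear_ops"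
  by (simp add: op_distributions0_def)

lemma op_distributions0_lincomb:
  "G \<in> op_distributions0 \<Longrightarrow> \<phi> \<in> test_funs \<Longrightarrow> \<psi> \<in> test_funs \<Longrightarrow>
    G (\<lambda>t. a * \<phi> t + b * \<psi> t) = a *\<^sub>C G \<phi> + b *\<^sub>C G \<psi>"
  by (simp add: op_distributions0_def distributions0_def distributions_def)

lemma test_funs0_uminus:
  assumes "\<phi> \<in> test_funs0"
  shows "(\<lambda>t. - \<phi> t) \<in> test_funs0"
  using test_funs0_lincomb[OF assms assms, of "-1" 0] by simp

text \<open>The generator relation says that the functional sending \<open>\<phi>\<close> to
  \<open>G \<phi>\<close> applied to \<open>x\<close> is an eigenfunctional of differentiation,
  which is the situation of \<open>linear_functional_shift\<close>.\<close>

lemma ds_generator_orbit: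
  assumes G: "G \<in> op_distributions0" and x: "(x, k *\<^sub>C x) \<in> ds_generator G" and t: "t \<ge> 0"
  shows "(x, exp (k * of_real t) *\<^sub>C x) \<in> dist_op G (delta t)"
  unfolding dist_op_def dist_conv_delta mem_Collect_eq prod.case
proof
  define L where "L = (\<lambda>\<phi>. blinfun_apply (G \<phi>) x)"
  fix \<phi> assume \<phi>: "\<phi> \<in> test_funs0"
  have "L (\<lambda>s. \<phi> (s - t)) = exp (k * of_real t) *\<^sub>C L \<phi>"
  proof (rule linear_functional_shift[OF _ _ \<phi> t])
    show *: "L (\<lambda>t. a * \<phi> t + b * \<psi> t) = a *\<^sub>C L \<phi> + b *\<^sub>C L \<psi>"
      if "\<phi> \<in> test_funs0" "\<psi> \<in> test_funs0" for \<phi> \<psi> a b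
      using that by (simp add: L_def op_distributions0_lincomb[OF G] test_funs0_imp
          blinfun.add_left scaleC_blinfun.rep_eq)
    show "L (vderiv \<phi>) = - k *\<^sub>C L \<phi>" if \<phi>: "\<phi> \<in> test_funs0" for \<phi>
    proof -
      have "L (\<lambda>s. - vderiv \<phi> s) = k *\<^sub>C L \<phi>"
        using x \<phi> op_distributions0_clinear[OF G test_funs0_imp[OF \<phi>]]
        by (simp add: ds_generator_iff L_def clinear_opsD)
      moreover have "L (\<lambda>s. - vderiv \<phi> s) = - L (vderiv \<phi>)"
        using *[OF test_funs0_vderiv[OF \<phi>] test_funs0_vderiv[OF \<phi>], of "-1" 0]
        by (simp add: scaleC_one)
      ultimately show ?thesis by (metis add.inverse_inverse complex_vector.scale_minus_left)
    qed
  qed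
  then show "blinfun_apply (G (\<lambda>s. \<phi> (s - t))) x = blinfun_apply (G \<phi>) (exp (k * of_real t) *\<^sub>C x)"
    using op_distributions0_clinear[OF G test_funs0_imp[OF \<phi>]] by (simp add: L_def clinear_opsD)
qed

section \<open>The corrected primitive and the inverse distribution\<close>

lemma primitive_test_funs:
  assumes \<zeta>: "cutoff \<zeta>" and \<phi>: "\<phi> \<in> test_funs"
  shows "primitive \<zeta> \<phi> \<in> test_funs"
    "integral {..s} \<phi> = primitive \<zeta> \<phi> s + integral UNIV \<phi> * integral {..s} \<zeta>"
proof -
  have z: "\<zeta> \<in> test_funs" "integral UNIV \<zeta> = 1" using \<zeta> by (auto simp: cutoff_def)
  \<comment> \<open>Because \<open>\<zeta>\<close> has integral \<open>1\<close>, subtracting this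
    multiple of it leaves mean zero, so the primitive of \<open>\<eta>\<close> has compact
    support.\<close>
  define \<eta> where "\<eta> = (\<lambda>t. 1 * \<phi> t + - integral UNIV \<phi> * \<zeta> t)"
  have p: "primitive \<zeta> \<phi> = (\<lambda>s. integral {..s} \<eta>)"
    by (simp add: primitive_def \<eta>_def mult.commute)
  have i: "integral S \<eta> = 1 * integral S \<phi> + - integral UNIV \<phi> * integral S \<zeta>"
    if "\<phi> integrable_on S" "\<zeta> integrable_on S" for S
    unfolding \<eta>_def using that
    by (intro integral_unique has_integral_add has_integral_mult_right integrable_integral)
  have "integral UNIV \<eta> = 0" using i[of UNIV] z \<phi> by (simp add: test_funs_integrable)
  then show "primitive \<zeta> \<phi> \<in> test_funs"
    unfolding p by (intro test_funs_integral) (simp_all only: \<eta>_def test_funs_lincomb \<phi> z)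
  show "integral {..s} \<phi> = primitive \<zeta> \<phi> s + integral UNIV \<phi> * integral {..s} \<zeta>"
    unfolding p using i[of "{..s}"] z \<phi> by (simp add: test_funs_integrable)
qed

text \<open>A derivative of a test function has mean zero, so the correction by
  \<open>\<zeta>\<close> disappears.\<close>

lemma primitive_vderiv:
  assumes "cutoff \<zeta>" "\<phi> \<in> test_funs"
  shows "primitive \<zeta> (vderiv \<phi>) = \<phi>"
  using primitive_test_funs(2)[OF assms(1) test_funs_vderiv[OF assms(2)]]
  by (simp add: fun_eq_iff test_funs_integral_UNIV_vderiv test_funs_integral_vderiv assms)

lemma primitive_lincomb:
  assumes \<zeta>: "cutoff \<zeta>" and "\<phi> \<in> test_funs" "\<psi> \<in> test_funs"
  shows "primitive \<zeta> (\<lambda>t. a * \<phi> t + b * \<psi> t) = (\<lambda>s. a * primitive \<zeta> \<phi> s + b * primitive \<zeta> \<psi> s)"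
proof
  fix s
  have i: "integral S (\<lambda>t. a * \<phi> t + b * \<psi> t) = a * integral S \<phi> + b * integral S \<psi>"
    if "\<phi> integrable_on S" "\<psi> integrable_on S" for S
    using that by (intro integral_unique has_integral_add has_integral_mult_right integrable_integral)
  show "primitive \<zeta> (\<lambda>t. a * \<phi> t + b * \<psi> t) s = a * primitive \<zeta> \<phi> s + b * primitive \<zeta> \<psi> s"
    using primitive_test_funs(2)[OF \<zeta> assms(2), of s] primitive_test_funs(2)[OF \<zeta> assms(3), of s]
      primitive_test_funs(2)[OF \<zeta> test_funs_lincomb[OF assms(2,3)], of s a b]
      i[of UNIV] i[of "{..s}"] assms(2,3)
    by (simp add: test_funs_integrable algebra_simps)
qed

lemma dist_inv_lincomb:
  assumes "cutoff \<zeta>" "G \<in> op_distributions0" "\<phi> \<in> test_funs" "\<psi> \<in> test_funs"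
  shows "dist_inv \<zeta> G (\<lambda>t. a * \<phi> t + b * \<psi> t) = a *\<^sub>C dist_inv \<zeta> G \<phi> + b *\<^sub>C dist_inv \<zeta> G \<psi>"
  using assms by (simp add: dist_inv_def primitive_lincomb op_distributions0_lincomb primitive_test_funs)

lemma clinear_ops_uminus: "T \<in> clinear_ops \<Longrightarrow> - T \<in> clinear_ops"
  by (simp add: clinear_ops_def blinfun.minus_left)

lemma dist_inv_clinear:
  assumes "cutoff \<zeta>" "G \<in> op_distributions0" "\<phi> \<in> test_funs"
  shows "dist_inv \<zeta> G \<phi> \<in> clinear_ops"
  using assms by (simp add: dist_inv_def primitive_test_funs clinear_ops_uminus op_distributions0_clinear)

text \<open>In other words, \<open>G\<close> is the distributional derivative of
  \<open>dist_inv \<zeta> G\<close>.\<close>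

lemma dist_inv_vderiv:
  assumes "cutoff \<zeta>" "\<phi> \<in> test_funs"
  shows "dist_inv \<zeta> G (vderiv \<phi>) = - G \<phi>"
  using assms by (simp add: dist_inv_def primitive_vderiv)

section \<open>The matrix semigroup of a cosine function\<close>

lemma dcf_semigroup_test_funs0:
  assumes "\<phi> \<in> test_funs0"
  shows "blinfun_apply (dcf_semigroup \<zeta> C G \<phi>) p =
    (blinfun_apply (G \<phi>) (fst p) + blinfun_apply (dist_inv \<zeta> G \<phi>) (snd p),
     - blinfun_apply (G (vderiv \<phi>)) (fst p) + blinfun_apply (G \<phi>) (snd p))"
  \<comment> \<open>As \<open>\<phi> 0 = 0\<close>, the multiple of \<open>C\<close> drops out of
    the lower left entry.\<close>
  using test_funs0_zero_at_0[OF assms, of 0]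
  by (simp add: dcf_semigroup_def block_op.rep_eq dist_deriv_def delta_def blinfun.minus_left)

lemma dcf_semigroup_clinear:
  assumes "cutoff \<zeta>" "G \<in> op_distributions0" "\<phi> \<in> test_funs0"
  shows "dcf_semigroup \<zeta> C G \<phi> \<in> clinear_ops"
  using assms test_funs0_vderiv[OF assms(3)]
  by (auto simp: clinear_ops_def dcf_semigroup_test_funs0 scaleC_prod_def scaleC_add_right
      complex_vector.scale_right_diff_distrib clinear_opsD[OF dist_inv_clinear] clinear_opsD[OF op_distributions0_clinear] test_funs0_imp)

text \<open>The orbit solves the first-order system with initial value \<open>(0, x)\<close>: its
  first coordinate is the sine solution and its second the derivative. Testing the two coordinates
  amounts to the cosine identity for \<open>\<phi>\<close> and for
  \<open>vderiv \<phi>\<close>.\<close>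

lemma dcf_generator_orbit:
  assumes \<zeta>: "cutoff \<zeta>" and G: "G \<in> op_distributions0"
    and x: "(x, - of_real (m\<^sup>2) *\<^sub>C x) \<in> dcf_generator \<zeta> G" and t: "t \<ge> 0"
  shows "((0, x), (sinC m t *\<^sub>C x, cosC m t *\<^sub>C x)) \<in> dist_op (dcf_semigroup \<zeta> C G) (delta t)"
  unfolding dist_op_def dist_conv_delta mem_Collect_eq prod.case
proof
  fix \<phi> assume \<phi>: "\<phi> \<in> test_funs0"
  define L where "L = (\<lambda>\<phi>. blinfun_apply (dist_inv \<zeta> G \<phi>) x)"
  have shift: "L (\<lambda>s. \<phi> (s - t)) = cosC m t *\<^sub>C L \<phi> - sinC m t *\<^sub>C L (vderiv \<phi>)"
    if "\<phi> \<in> test_funs0" for \<phi>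
  proof (rule linear_functional_shift_cos[OF _ _ that t])
    show "L (\<lambda>t. a * \<phi> t + b * \<psi> t) = a *\<^sub>C L \<phi> + b *\<^sub>C L \<psi>"
      if "\<phi> \<in> test_funs0" "\<psi> \<in> test_funs0" for \<phi> \<psi> a b
      using that by (simp add: L_def dist_inv_lincomb[OF \<zeta> G] test_funs0_imp
          blinfun.add_left scaleC_blinfun.rep_eq)
    show "L (vderiv (vderiv \<phi>)) = - of_real (m\<^sup>2) *\<^sub>C L \<phi>" if \<phi>: "\<phi> \<in> test_funs0" for \<phi>
    proof -
      have "L (vderiv (vderiv \<phi>)) = blinfun_apply (dist_inv \<zeta> G \<phi>) (- of_real (m\<^sup>2) *\<^sub>C x)"
        using x \<phi> unfolding dcf_generator_def L_def by blast
      then show ?thesis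
        by (simp only: L_def clinear_opsD[OF dist_inv_clinear[OF \<zeta> G test_funs0_imp[OF \<phi>]]])
    qed
  qed
  have L': "L (vderiv \<psi>) = - blinfun_apply (G \<psi>) x" if "\<psi> \<in> test_funs0" for \<psi>
    using that by (simp add: L_def dist_inv_vderiv[OF \<zeta>] test_funs0_imp blinfun.minus_left)
  note lin = clinear_opsD[OF dist_inv_clinear[OF \<zeta> G test_funs0_imp]]
    clinear_opsD[OF op_distributions0_clinear[OF G test_funs0_imp]]
  have s: "(\<lambda>s. \<phi> (s - t)) \<in> test_funs0" by (rule test_funs0_shift[OF \<phi> t])
  have 1: "blinfun_apply (dist_inv \<zeta> G (\<lambda>s. \<phi> (s - t))) x =
      cosC m t *\<^sub>C blinfun_apply (dist_inv \<zeta> G \<phi>) x + sinC m t *\<^sub>C blinfun_apply (G \<phi>) x"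
    using shift[OF \<phi>] by (simp add: L'[OF \<phi>]) (simp add: L_def)
  \<comment> \<open>\<open>L'\<close> trades \<open>G\<close> for \<open>L\<close> at a derivative,
    and differentiation commutes with translation, so \<open>shift\<close> applies to
    \<open>vderiv \<phi>\<close>.\<close>
  have "- blinfun_apply (G (\<lambda>s. \<phi> (s - t))) x = L (\<lambda>s. vderiv \<phi> (s - t))"
    using L'[OF s] by (simp add: vderiv_shift test_funs_smooth test_funs0_imp \<phi>)
  also have "\<dots> = - (cosC m t *\<^sub>C blinfun_apply (G \<phi>) x) + sinC m t *\<^sub>C blinfun_apply (G (vderiv \<phi>)) x"
    by (simp add: shift test_funs0_vderiv \<phi> L')
  finally have 2: "blinfun_apply (G (\<lambda>s. \<phi> (s - t))) x =
      cosC m t *\<^sub>C blinfun_apply (G \<phi>) x - sinC m t *\<^sub>C blinfun_apply (G (vderiv \<phi>)) x"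
    by (simp add: minus_equation_iff[of "blinfun_apply (G (\<lambda>s. \<phi> (s - t))) x"])
  show "blinfun_apply (dcf_semigroup \<zeta> C G (\<lambda>s. \<phi> (s - t))) (0, x) =
      blinfun_apply (dcf_semigroup \<zeta> C G \<phi>) (sinC m t *\<^sub>C x, cosC m t *\<^sub>C x)"
    by (simp add: dcf_semigroup_test_funs0 s \<phi> 1 2 lin test_funs0_vderiv blinfun.zero_right)
qed

section \<open>Almost periodicity on the spans of eigenvectors\<close>

lemma C_DS_orbits:
  assumes G: "C_DS C G"
    and S: "S = cspan (eigenvectors (ds_generator G) (range (\<lambda>r::real. \<i> * complex_of_real r)))"
    and S0: "S0 = cspan (eigenvectors (ds_generator G) (range (\<lambda>r::real. \<i> * complex_of_real r) - {0}))"
  shows "ds_almost_periodic G S"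
    "x \<in> S0 \<Longrightarrow> almost_periodic (\<lambda>t. integral {0..t} (ds_orbit G x))"
proof -
  let ?A = "ds_generator G" and ?R = "\<lambda>t. dist_op G (delta t)"
  have op: "G \<in> op_distributions0" using G by (simp add: C_DS_def)
  have sub: "csubspace (?R t)" if "t \<ge> 0" for t
    by (intro csubspace_dist_op_delta op_distributions0_clinear[OF op] test_funs0_imp that)
  have A: "csubspace ?A"
  proof -
    have "?A = {(x, y). \<forall>\<phi>\<in>test_funs0. blinfun_apply (G (\<lambda>s. - vderiv \<phi> s)) x = blinfun_apply (G \<phi>) y}"
      by (auto simp: ds_generator_iff)
    also have "csubspace \<dots>"
      by (intro csubspace_eq_graph op_distributions0_clinear[OF op] test_funs0_imp
          test_funs0_uminus test_funs0_vderiv)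
    finally show ?thesis .
  qed
  have orbit: "ds_orbit G x t = y" if "(x, y) \<in> ?R t" for x y t
    unfolding ds_orbit_def using G that by (intro graph_apply_dist_op) (auto simp: C_DS_def)
  \<comment> \<open>For \<open>r = 0\<close> the primitive is \<open>t *\<^sub>C x\<close>, which is
    not almost periodic. Hence \<open>B\<close> stays open: trivial for \<open>S\<close>, and
    \<open>bohr\<close> for \<open>S0\<close>, where \<open>r \<noteq> 0\<close>.\<close>
  have eig: "orbit_in B ?R (\<lambda>_ _. 1) ?A x"
    if "(x, (\<i> * of_real r) *\<^sub>C x) \<in> ?A"
      "B (\<lambda>t. (if r = 0 then of_real t else (cis (r * t) - 1) / (\<i> * r)) *\<^sub>C x)" for B r x
  proof (rule orbit_in_eigenvector[where a = "\<lambda>t. cis (r * t)", OF A that(1) bohr_cis, of B])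
    show "(x, cis (r * t) *\<^sub>C x) \<in> ?R t" if "t \<ge> 0" for t
      using ds_generator_orbit[OF op \<open>(x, _) \<in> _\<close> that] by (simp add: cis_conv_exp mult.assoc)
    show "((\<lambda>s. 1 *\<^sub>R cis (r * s)) has_integral
        (if r = 0 then of_real t else (cis (r * t) - 1) / (\<i> * r))) {0..t}" if "t \<ge> 0" for t
      using cis_has_integral[OF that] by simp
  qed (use that in auto)
  have "orbit_in (\<lambda>_. True) ?R (\<lambda>_ _. 1) ?A x" if "x \<in> S" for x
    using that unfolding S
    by (rule orbit_in_span[OF sub A, rotated -1]) (auto simp: eigenvectors_def intro: eig)
  then have *: "\<exists>u. bohr u \<and> (\<forall>t\<ge>0. (x, u t) \<in> ?R t \<and> (integral {0..t} u, u t - x) \<in> ?A)"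
    if "x \<in> S" for x
    using that unfolding orbit_in_def by (fastforce dest: integral_unique)
  show "ds_almost_periodic G S"
    unfolding ds_almost_periodic_def
  proof (intro conjI ballI)
    show "csubspace S" unfolding S by (rule complex_vector.subspace_span)
    show "S \<subseteq> solution_space ?A"
      unfolding solution_space_def using * bohr_continuous by blast
    fix x assume "x \<in> S"
    then obtain u where u: "bohr u" "\<forall>t\<ge>0. (x, u t) \<in> ?R t" using * by blast
    then show "\<forall>t\<ge>0. x \<in> Domain (?R t)" by blast
    show "almost_periodic (ds_orbit G x)"
      by (rule bohr_almost_periodic[OF u(1)]) (use u(2) orbit in blast)
  qed
  assume "x \<in> S0"
  then have "orbit_in bohr ?R (\<lambda>_ _. 1) ?A x"
    unfolding S0
  proof (rule orbit_in_span[OF sub A, rotated -1])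
    fix x assume "x \<in> eigenvectors ?A (range (\<lambda>r::real. \<i> * complex_of_real r) - {0})"
    then obtain r where r: "(x, (\<i> * of_real r) *\<^sub>C x) \<in> ?A" "r \<noteq> 0"
      by (force simp: eigenvectors_def)
    \<comment> \<open>The primitive of the character, split into a multiple of it plus a
      constant.\<close>
    have "bohr (\<lambda>t. (1 / (\<i> * r) * cis (r * t) + - 1 / (\<i> * r)) *\<^sub>C x)"
      by (intro bohr_scaleC_left bohr_add bohr_cmult bohr_cis bohr_const)
    then show "orbit_in bohr ?R (\<lambda>_ _. 1) ?A x"
      using r by (intro eig[OF r(1)]) (simp add: diff_divide_distrib)
  qed (auto intro!: bohr_const bohr_add bohr_scaleC)
  then obtain u U where u: "bohr U" "\<And>t. t \<ge> 0 \<Longrightarrow> (x, u t) \<in> ?R t"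
    "\<And>t. t \<ge> 0 \<Longrightarrow> (u has_integral U t) {0..t}"
    unfolding orbit_in_def by auto
  show "almost_periodic (\<lambda>t. integral {0..t} (ds_orbit G x))"
  proof (rule bohr_almost_periodic[OF u(1)])
    fix t :: real assume "t \<ge> 0"
    then have "integral {0..t} (ds_orbit G x) = integral {0..t} u"
      by (intro integral_cong orbit u(2)) auto
    then show "integral {0..t} (ds_orbit G x) = U t"
      using integral_unique[OF u(3)] \<open>t \<ge> 0\<close> by simp
  qed
qed

lemma C_DCF_orbits:
  assumes \<zeta>: "cutoff \<zeta>" and G: "C_DCF \<zeta> C G"
    and S: "S = cspan (eigenvectors (dcf_generator \<zeta> G) (complex_of_real ` {..0}))"
    and S0: "S0 = cspan (eigenvectors (dcf_generator \<zeta> G) (complex_of_real ` {..<0}))"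
  shows "dcf_almost_periodic \<zeta> C G S"
    "x \<in> S0 \<Longrightarrow> almost_periodic (\<lambda>t. integral {0..t} (dcf_orbit \<zeta> C G x))"
    "x \<in> S0 \<Longrightarrow> almost_periodic (\<lambda>t. integral {0..t} (\<lambda>s. (t - s) *\<^sub>R dcf_orbit \<zeta> C G x s))"
proof -
  let ?A = "dcf_generator \<zeta> G" and ?D = "\<lambda>t. dist_op (dcf_semigroup \<zeta> C G) (delta t)"
  \<comment> \<open>The relation on the second coordinate alone: the first coordinate of the orbit
    of \<open>(0, x)\<close> is projected away, which keeps a subspace.\<close>
  let ?R = "\<lambda>t. {(x, y). \<exists>v. ((0, x), (v, y)) \<in> ?D t}"
  have op: "G \<in> op_distributions0" using G by (simp add: C_DCF_def)
  have sub: "csubspace (?R t)" if "t \<ge> 0" for t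
  proof -
    have D: "csubspace (?D t)"
      by (intro csubspace_dist_op_delta dcf_semigroup_clinear \<zeta> op that)
    note D0 = complex_vector.subspace_0[OF D] and Da = complex_vector.subspace_add[OF D]
      and Ds = complex_vector.subspace_scale[OF D]
    show ?thesis unfolding complex_vector.subspace_def
    proof (intro conjI ballI allI)
      show "0 \<in> ?R t" using D0 by (auto simp: zero_prod_def)
      show "p + q \<in> ?R t" if "p \<in> ?R t" "q \<in> ?R t" for p q
        using that Da by (auto, fastforce)
      show "c *\<^sub>C p \<in> ?R t" if "p \<in> ?R t" for c p
        using that Ds by (auto simp: scaleC_prod_def, fastforce)
    qed
  qed
  have A: "csubspace ?A"
    unfolding dcf_generator_def
    by (intro csubspace_eq_graph dist_inv_clinear \<zeta> op test_funs0_imp test_funs0_vderiv)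
  \<comment> \<open>The first coordinates alone give the nondegeneracy condition of
    \<open>C_DCF\<close>.\<close>
  have ker: "p = 0" if "\<And>\<phi>. \<phi> \<in> test_funs0 \<Longrightarrow> blinfun_apply (dcf_semigroup \<zeta> C G \<phi>) p = 0" for p
  proof -
    have "\<forall>\<phi>\<in>test_funs0. blinfun_apply (G \<phi>) (fst p) + blinfun_apply (dist_inv \<zeta> G \<phi>) (snd p) = 0"
      using that by (simp add: dcf_semigroup_test_funs0 zero_prod_def)
    then show ?thesis using G by (simp add: C_DCF_def prod_eq_iff)
  qed
  have orbit: "dcf_orbit \<zeta> C G x t = y" if xy: "(x, y) \<in> ?R t" for x y t
  proof -
    obtain v where "((0, x), (v, y)) \<in> ?D t" using xy by auto
    from graph_apply_dist_op[OF ker this] show ?thesis by (simp add: dcf_orbit_def)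
  qed
  have R: "(x, cosC m t *\<^sub>C x) \<in> ?R t" if "(x, - of_real (m\<^sup>2) *\<^sub>C x) \<in> ?A" "t \<ge> 0" for x m t
    using dcf_generator_orbit[OF \<zeta> op that] by blast
  have eig: "orbit_in B ?R (\<lambda>t s. t - s) ?A x"
    if "(x, - of_real (m\<^sup>2) *\<^sub>C x) \<in> ?A"
      "B (\<lambda>t. of_real (if m = 0 then t\<^sup>2 / 2 else (1 - cos (m * t)) / m\<^sup>2) *\<^sub>C x)" for B m x
    by (rule orbit_in_eigenvector[where a = "cosC m" and B = B, OF A that(1) bohr_cosC that(2)
          R[OF that(1)] cosC_has_integral2])
      (auto simp: cosC_def)
  \<comment> \<open>A non-positive eigenvalue \<open>l\<close> is \<open>- m\<^sup>2\<close> for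
    \<open>m = sqrt (- l)\<close>.\<close>
  have root: "\<exists>m. (x, - of_real (m\<^sup>2) *\<^sub>C x) \<in> ?A \<and> (l < 0 \<longrightarrow> m \<noteq> 0)"
    if "(x, complex_of_real l *\<^sub>C x) \<in> ?A" "l \<le> 0" for x l
    by (rule exI[of _ "sqrt (- l)"]) (use that in auto)
  have ap: "orbit_in (\<lambda>_. True) ?R (\<lambda>t s. t - s) ?A x" if "x \<in> S" for x
    using that unfolding S
  proof (rule orbit_in_span[OF sub A, rotated -1])
    fix x assume "x \<in> eigenvectors ?A (complex_of_real ` {..0})"
    then obtain m where "(x, - of_real (m\<^sup>2) *\<^sub>C x) \<in> ?A"
      using root by (auto simp: eigenvectors_def)
    then show "orbit_in (\<lambda>_. True) ?R (\<lambda>t s. t - s) ?A x" by (rule eig) simp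
  qed auto
  have *: "\<exists>u. bohr u \<and> (\<forall>t\<ge>0. (x, u t) \<in> ?R t \<and>
      (integral {0..t} (\<lambda>s. (t - s) *\<^sub>R u s), u t - x) \<in> ?A)"
    if xS: "x \<in> S" for x
  proof -
    obtain u U where u: "bohr u" "\<And>t. t \<ge> 0 \<Longrightarrow> (x, u t) \<in> ?R t"
      "\<And>t. t \<ge> 0 \<Longrightarrow> ((\<lambda>s. (t - s) *\<^sub>R u s) has_integral U t) {0..t}"
      "\<And>t. t \<ge> 0 \<Longrightarrow> (U t, u t - x) \<in> ?A"
      using ap[OF xS] unfolding orbit_in_def by blast
    have "(integral {0..t} (\<lambda>s. (t - s) *\<^sub>R u s), u t - x) \<in> ?A" if "t \<ge> 0" for t
      using u(4)[OF that] by (simp only: integral_unique[OF u(3)[OF that]])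
    with u show ?thesis by blast
  qed
  show "dcf_almost_periodic \<zeta> C G S"
    unfolding dcf_almost_periodic_def
  proof (intro conjI ballI)
    show "csubspace S" unfolding S by (rule complex_vector.subspace_span)
    show "S \<subseteq> solution_space2 ?A"
    proof
      fix x assume "x \<in> S"
      from *[OF this] obtain u where u: "bohr u"
        "\<forall>t\<ge>0. (integral {0..t} (\<lambda>s. (t - s) *\<^sub>R u s), u t - x) \<in> ?A" by blast
      then show "x \<in> solution_space2 ?A"
        unfolding solution_space2_def using bohr_continuous[OF u(1)] by blast
    qed
    fix x assume "x \<in> S"
    from *[OF this] obtain u where u: "bohr u" "\<forall>t\<ge>0. (x, u t) \<in> ?R t" by blast
    show "\<forall>t\<ge>0. (0, x) \<in> Domain (?D t)" using u(2) by blast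
    show "almost_periodic (dcf_orbit \<zeta> C G x)"
    proof (rule bohr_almost_periodic[OF u(1)])
      show "dcf_orbit \<zeta> C G x t = u t" if "t \<ge> 0" for t
        using u(2) that by (intro orbit) blast
    qed
  qed
  \<comment> \<open>Both integrals of the orbit are treated together: \<open>w\<close> is the
    kernel, and \<open>B\<close> the relation demanded of the primitive.\<close>
  have int: "almost_periodic (\<lambda>t. integral {0..t} (\<lambda>s. w t s *\<^sub>R dcf_orbit \<zeta> C G x s))"
    if "x \<in> S0" "csubspace B" "\<And>x m. (x, - of_real (m\<^sup>2) *\<^sub>C x) \<in> ?A \<Longrightarrow> m \<noteq> 0 \<Longrightarrow>
      orbit_in bohr ?R w B x" for w B
  proof -
    have "orbit_in bohr ?R w B x"
      using that(1) unfolding S0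
    proof (rule orbit_in_span[OF sub that(2), rotated -1])
      fix x assume "x \<in> eigenvectors ?A (complex_of_real ` {..<0})"
      then obtain l where l: "(x, complex_of_real l *\<^sub>C x) \<in> ?A" "l < 0"
        by (auto simp: eigenvectors_def)
      then obtain m where "(x, - of_real (m\<^sup>2) *\<^sub>C x) \<in> ?A" "m \<noteq> 0"
        using root[OF l(1)] by auto
      then show "orbit_in bohr ?R w B x" by (rule that(3))
    qed (auto intro!: bohr_const bohr_add bohr_scaleC)
    then obtain u U where u: "bohr U" "\<And>t. t \<ge> 0 \<Longrightarrow> (x, u t) \<in> ?R t"
      "\<And>t. t \<ge> 0 \<Longrightarrow> ((\<lambda>s. w t s *\<^sub>R u s) has_integral U t) {0..t}"
      unfolding orbit_in_def by blast
    show ?thesis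
    proof (rule bohr_almost_periodic[OF u(1)])
      fix t :: real assume "t \<ge> 0"
      have "integral {0..t} (\<lambda>s. w t s *\<^sub>R dcf_orbit \<zeta> C G x s) = integral {0..t} (\<lambda>s. w t s *\<^sub>R u s)"
        using orbit[OF u(2)] by (intro integral_cong) auto
      then show "integral {0..t} (\<lambda>s. w t s *\<^sub>R dcf_orbit \<zeta> C G x s) = U t"
        using integral_unique[OF u(3)] \<open>t \<ge> 0\<close> by simp
    qed
  qed
  show "almost_periodic (\<lambda>t. integral {0..t} (\<lambda>s. (t - s) *\<^sub>R dcf_orbit \<zeta> C G x s))" if "x \<in> S0"
  proof (rule int[OF that A eig])
    fix m :: real and x :: 'a assume "m \<noteq> 0"
    \<comment> \<open>The double integral \<open>(1 - cos (m * t)) / m\<^sup>2\<close> as a constant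
      plus a multiple of \<open>cosC\<close>.\<close>
    have "bohr (\<lambda>t. (of_real (1 / m\<^sup>2) + of_real (- 1 / m\<^sup>2) * cosC m t) *\<^sub>C x)"
      by (intro bohr_scaleC_left bohr_add bohr_cmult bohr_cosC bohr_const)
    then show "bohr (\<lambda>t. complex_of_real (if m = 0 then t\<^sup>2 / 2 else (1 - cos (m * t)) / m\<^sup>2) *\<^sub>C x)"
      using \<open>m \<noteq> 0\<close> by (simp add: cosC_def diff_divide_distrib)
  qed
  show "almost_periodic (\<lambda>t. integral {0..t} (dcf_orbit \<zeta> C G x))" if "x \<in> S0"
  proof -
    \<comment> \<open>The generator relation concerns the double integral. The single integral
      \<open>sinC m t *\<^sub>C x\<close> is only asked to be almost periodic, so
      \<open>UNIV\<close> replaces \<open>?A\<close>.\<close>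
    have "orbit_in bohr ?R (\<lambda>_ _. 1) UNIV x" if x: "(x, - of_real (m\<^sup>2) *\<^sub>C x) \<in> ?A" "m \<noteq> 0" for x m
      unfolding orbit_in_def
    proof (rule exI[of _ "\<lambda>t. cosC m t *\<^sub>C x"], rule exI[of _ "\<lambda>t. sinC m t *\<^sub>C x"],
        intro conjI allI impI)
      show "((\<lambda>s. 1 *\<^sub>R cosC m s *\<^sub>C x) has_integral sinC m t *\<^sub>C x) {0..t}" if "t \<ge> 0" for t
        using has_integral_linear[OF cosC_has_integral[OF that] bounded_linear_scaleC_left]
        by (simp add: o_def)
    qed (use R[OF x(1)] bohr_sinC[OF x(2)] in \<open>auto intro!: bohr_scaleC_left bohr_cosC\<close>)
    from int[OF that complex_vector.subspace_UNIV this] show ?thesis by simp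
  qed
qed

theorem proposition2p3:
  fixes C :: "'e::complex_banach \<Rightarrow>\<^sub>L 'e"
  assumes "C \<in> clinear_ops" and "inj (blinfun_apply C)"
  shows
    "(\<forall>(G :: (real \<Rightarrow> complex) \<Rightarrow> ('e \<Rightarrow>\<^sub>L 'e)) A D D0.
        C_DS C G \<and> A = ds_generator G \<and>
        D = eigenvectors A (range (\<lambda>r::real. \<i> * complex_of_real r)) \<and>
        D0 = eigenvectors A (range (\<lambda>r::real. \<i> * complex_of_real r) - {0}) \<longrightarrow>
        cspan D \<subseteq> solution_space A \<and>
        ds_almost_periodic G (cspan D) \<and>
        (\<forall>x\<in>cspan D0. almost_periodic (\<lambda>t. integral {0..t} (ds_orbit G x))))
     \<and>
     (\<forall>\<zeta> (G :: (real \<Rightarrow> complex) \<Rightarrow> ('e \<Rightarrow>\<^sub>L 'e)) A H H0.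
        cutoff \<zeta> \<and> C_DCF \<zeta> C G \<and> A = dcf_generator \<zeta> G \<and>
        H = eigenvectors A (complex_of_real ` {..0}) \<and>
        H0 = eigenvectors A (complex_of_real ` {..<0}) \<longrightarrow>
        cspan H \<subseteq> solution_space2 A \<and>
        dcf_almost_periodic \<zeta> C G (cspan H) \<and>
        (\<forall>x\<in>cspan H0.
          almost_periodic (\<lambda>t. integral {0..t} (dcf_orbit \<zeta> C G x)) \<and>
          almost_periodic (\<lambda>t. integral {0..t} (\<lambda>s. (t - s) *\<^sub>R dcf_orbit \<zeta> C G x s))))"
proof (intro conjI allI impI; elim conjE)
  fix G :: "(real \<Rightarrow> complex) \<Rightarrow> ('e \<Rightarrow>\<^sub>L 'e)" and A D D0
  assume h: "C_DS C G" "A = ds_generator G"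
    "D = eigenvectors A (range (\<lambda>r::real. \<i> * complex_of_real r))"
    "D0 = eigenvectors A (range (\<lambda>r::real. \<i> * complex_of_real r) - {0})"
  have "ds_almost_periodic G (cspan D)"
    "\<forall>x\<in>cspan D0. almost_periodic (\<lambda>t. integral {0..t} (ds_orbit G x))"
    using C_DS_orbits[OF h(1) refl refl] unfolding h(2-4) by auto
  then show "cspan D \<subseteq> solution_space A" "ds_almost_periodic G (cspan D)"
    "\<forall>x\<in>cspan D0. almost_periodic (\<lambda>t. integral {0..t} (ds_orbit G x))"
    using h(2) by (auto simp: ds_almost_periodic_def)
next
  fix \<zeta> and G :: "(real \<Rightarrow> complex) \<Rightarrow> ('e \<Rightarrow>\<^sub>L 'e)" and A H H0
  assume h: "cutoff \<zeta>" "C_DCF \<zeta> C G" "A = dcf_generator \<zeta> G"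
    "H = eigenvectors A (complex_of_real ` {..0})"
    "H0 = eigenvectors A (complex_of_real ` {..<0})"
  have "dcf_almost_periodic \<zeta> C G (cspan H)"
    "\<forall>x\<in>cspan H0. almost_periodic (\<lambda>t. integral {0..t} (dcf_orbit \<zeta> C G x)) \<and>
      almost_periodic (\<lambda>t. integral {0..t} (\<lambda>s. (t - s) *\<^sub>R dcf_orbit \<zeta> C G x s))"
    using C_DCF_orbits[OF h(1,2) refl refl] unfolding h(3-5) by auto
  then show "cspan H \<subseteq> solution_space2 A" "dcf_almost_periodic \<zeta> C G (cspan H)"
    "\<forall>x\<in>cspan H0. almost_periodic (\<lambda>t. integral {0..t} (dcf_orbit \<zeta> C G x)) \<and>
      almost_periodic (\<lambda>t. integral {0..t} (\<lambda>s. (t - s) *\<^sub>R dcf_orbit \<zeta> C G x s))"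
    using h(3) by (auto simp: dcf_almost_periodic_def)
qed

end
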